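(* Let $\mathcal{C}$ and $\mathcal{D}$ be categories and let $F:\mathcal{C}\to\mathcal{D}$, $G:\mathcal{D}\to\mathcal{C}$ be functors such that $(F,G)$ is a Frobenius pair of the second kind between $\mathcal{C}$ and $\mathcal{D}$. Then: 1) $F$ and $G$ preserve limits and colimits and, in particular, products and coproducts, kernels and cokernels, initial and final objects. 2) If $\mathcal{C}$ and $\mathcal{D}$ are abelian categories, then $F$ and $G$ are exact, and preserve injective and projective objects.
   Context: A pair of covariant functors $F:\mathcal{C}\to\mathcal{D}$, $G:\mathcal{D}\to\mathcal{C}$ is called a Frobenius pair of the second kind if there exist equivalences of categories $\alpha:\mathcal{C}\to\mathcal{C}$ and $\beta:\mathcal{D}\to\mathcal{D}$ such that $G$ is a right adjoint of $F$ and $G$ is a left adjoint of $\beta F\alpha:\mathcal{C}\to\mathcal{D}$. *)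

theory Defs
  imports "HOL-Algebra.Group"
begin

section \<open>Categories, functors, natural transformations\<close>

record ('o, 'm) cat =
  Obj :: "'o set"
  Arr :: "'m set"
  Dom :: "'m \<Rightarrow> 'o"
  Cod :: "'m \<Rightarrow> 'o"
  Ident :: "'o \<Rightarrow> 'm"
  Comp :: "'m \<Rightarrow> 'm \<Rightarrow> 'm" (infixl "\<cdot>\<index>" 70)

definition Hom :: "('o, 'm) cat \<Rightarrow> 'o \<Rightarrow> 'o \<Rightarrow> 'm set" where
  "Hom C a b = {f \<in> Arr C. Dom C f = a \<and> Cod C f = b}"

text \<open>Composition is written in applicative order: \<open>g \<cdot> f\<close> is \<open>f\<close> followed by \<open>g\<close>.
  Its value on non-composable pairs is irrelevant.\<close>

locale category =
  fixes C :: "('o, 'm) cat" (structure)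
  assumes Dom_in_Obj: "f \<in> Arr C \<Longrightarrow> Dom C f \<in> Obj C"
    and Cod_in_Obj: "f \<in> Arr C \<Longrightarrow> Cod C f \<in> Obj C"
    and Ident_in_Hom: "a \<in> Obj C \<Longrightarrow> Ident C a \<in> Hom C a a"
    and Comp_in_Hom: "\<lbrakk>f \<in> Hom C a b; g \<in> Hom C b c\<rbrakk> \<Longrightarrow> g \<cdot> f \<in> Hom C a c"
    and Comp_Ident: "f \<in> Hom C a b \<Longrightarrow> f \<cdot> Ident C a = f"
    and Ident_Comp: "f \<in> Hom C a b \<Longrightarrow> Ident C b \<cdot> f = f"
    and Comp_assoc: "\<lbrakk>f \<in> Hom C a b; g \<in> Hom C b c; h \<in> Hom C c d\<rbrakk>
          \<Longrightarrow> (h \<cdot> g) \<cdot> f = h \<cdot> (g \<cdot> f)"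

record ('a, 'b, 'c, 'd) funct =
  OMap :: "'a \<Rightarrow> 'c"
  AMap :: "'b \<Rightarrow> 'd"

locale is_functor = source: category C + target: category D
  for C :: "('a, 'b) cat" and D :: "('c, 'd) cat" +
  fixes F :: "('a, 'b, 'c, 'd) funct"
  assumes OMap_in_Obj: "a \<in> Obj C \<Longrightarrow> OMap F a \<in> Obj D"
    and AMap_in_Hom: "f \<in> Hom C a b \<Longrightarrow> AMap F f \<in> Hom D (OMap F a) (OMap F b)"
    and AMap_Ident: "a \<in> Obj C \<Longrightarrow> AMap F (Ident C a) = Ident D (OMap F a)"
    and AMap_Comp: "\<lbrakk>f \<in> Hom C a b; g \<in> Hom C b c\<rbrakk>
          \<Longrightarrow> AMap F (g \<cdot>\<^bsub>C\<^esub> f) = AMap F g \<cdot>\<^bsub>D\<^esub> AMap F f"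

definition id_funct :: "('a, 'b, 'a, 'b) funct" where
  "id_funct = \<lparr>OMap = (\<lambda>a. a), AMap = (\<lambda>f. f)\<rparr>"

definition comp_funct ::
  "('c, 'd, 'e, 'f) funct \<Rightarrow> ('a, 'b, 'c, 'd) funct \<Rightarrow> ('a, 'b, 'e, 'f) funct"
  (infixl "\<circ>\<^sub>F" 70) where
  "G \<circ>\<^sub>F F = \<lparr>OMap = (\<lambda>a. OMap G (OMap F a)), AMap = (\<lambda>f. AMap G (AMap F f))\<rparr>"

definition nat_trans ::
  "('a, 'b) cat \<Rightarrow> ('c, 'd) cat \<Rightarrow> ('a, 'b, 'c, 'd) funct \<Rightarrow> ('a, 'b, 'c, 'd) funct
    \<Rightarrow> ('a \<Rightarrow> 'd) \<Rightarrow> bool" where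
  "nat_trans C D F G \<tau> \<longleftrightarrow>
     (\<forall>a\<in>Obj C. \<tau> a \<in> Hom D (OMap F a) (OMap G a)) \<and>
     (\<forall>f\<in>Arr C. AMap G f \<cdot>\<^bsub>D\<^esub> \<tau> (Dom C f) = \<tau> (Cod C f) \<cdot>\<^bsub>D\<^esub> AMap F f)"

definition is_iso :: "('o, 'm) cat \<Rightarrow> 'm \<Rightarrow> bool" where
  "is_iso C f \<longleftrightarrow> f \<in> Arr C \<and>
     (\<exists>g \<in> Hom C (Cod C f) (Dom C f).
        g \<cdot>\<^bsub>C\<^esub> f = Ident C (Dom C f) \<and> f \<cdot>\<^bsub>C\<^esub> g = Ident C (Cod C f))"

definition nat_isomorphic ::
  "('a, 'b) cat \<Rightarrow> ('c, 'd) cat \<Rightarrow> ('a, 'b, 'c, 'd) funct \<Rightarrow> ('a, 'b, 'c, 'd) funct \<Rightarrow> bool" where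
  "nat_isomorphic C D F G \<longleftrightarrow>
     (\<exists>\<tau>. nat_trans C D F G \<tau> \<and> (\<forall>a\<in>Obj C. is_iso D (\<tau> a)))"

definition equivalence :: "('a, 'b) cat \<Rightarrow> ('c, 'd) cat \<Rightarrow> ('a, 'b, 'c, 'd) funct \<Rightarrow> bool" where
  "equivalence C D F \<longleftrightarrow> is_functor C D F \<and>
     (\<exists>G. is_functor D C G \<and>
          nat_isomorphic C C (G \<circ>\<^sub>F F) id_funct \<and> nat_isomorphic D D (F \<circ>\<^sub>F G) id_funct)"

text \<open>\<open>F : C \<rightarrow> D\<close> is left adjoint to \<open>G : D \<rightarrow> C\<close>, by unit, counit and the triangle identities.\<close>

definition adjoint ::
  "('a, 'b) cat \<Rightarrow> ('c, 'd) cat \<Rightarrow> ('a, 'b, 'c, 'd) funct \<Rightarrow> ('c, 'd, 'a, 'b) funct \<Rightarrow> bool" where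
  "adjoint C D F G \<longleftrightarrow> is_functor C D F \<and> is_functor D C G \<and>
     (\<exists>\<eta> \<epsilon>. nat_trans C C id_funct (G \<circ>\<^sub>F F) \<eta> \<and> nat_trans D D (F \<circ>\<^sub>F G) id_funct \<epsilon> \<and>
        (\<forall>c\<in>Obj C. \<epsilon> (OMap F c) \<cdot>\<^bsub>D\<^esub> AMap F (\<eta> c) = Ident D (OMap F c)) \<and>
        (\<forall>d\<in>Obj D. AMap G (\<epsilon> d) \<cdot>\<^bsub>C\<^esub> \<eta> (OMap G d) = Ident C (OMap G d)))"

definition frobenius_pair_second_kind ::
  "('a, 'b) cat \<Rightarrow> ('c, 'd) cat \<Rightarrow> ('a, 'b, 'c, 'd) funct \<Rightarrow> ('c, 'd, 'a, 'b) funct \<Rightarrow> bool" where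
  "frobenius_pair_second_kind C D F G \<longleftrightarrow> is_functor C D F \<and> is_functor D C G \<and>
     (\<exists>\<alpha> \<beta>. equivalence C C \<alpha> \<and> equivalence D D \<beta> \<and>
        adjoint C D F G \<and> adjoint D C G (\<beta> \<circ>\<^sub>F F \<circ>\<^sub>F \<alpha>))"


section \<open>Limits and colimits\<close>

definition is_cone ::
  "('i, 'j) cat \<Rightarrow> ('o, 'm) cat \<Rightarrow> ('i, 'j, 'o, 'm) funct \<Rightarrow> 'o \<Rightarrow> ('i \<Rightarrow> 'm) \<Rightarrow> bool" where
  "is_cone J C T L \<pi> \<longleftrightarrow> L \<in> Obj C \<and> (\<forall>i\<in>Obj J. \<pi> i \<in> Hom C L (OMap T i)) \<and>
     (\<forall>f\<in>Arr J. AMap T f \<cdot>\<^bsub>C\<^esub> \<pi> (Dom J f) = \<pi> (Cod J f))"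

definition is_limit ::
  "('i, 'j) cat \<Rightarrow> ('o, 'm) cat \<Rightarrow> ('i, 'j, 'o, 'm) funct \<Rightarrow> 'o \<Rightarrow> ('i \<Rightarrow> 'm) \<Rightarrow> bool" where
  "is_limit J C T L \<pi> \<longleftrightarrow> is_cone J C T L \<pi> \<and>
     (\<forall>M \<mu>. is_cone J C T M \<mu> \<longrightarrow>
        (\<exists>!u. u \<in> Hom C M L \<and> (\<forall>i\<in>Obj J. \<pi> i \<cdot>\<^bsub>C\<^esub> u = \<mu> i)))"

definition is_cocone ::
  "('i, 'j) cat \<Rightarrow> ('o, 'm) cat \<Rightarrow> ('i, 'j, 'o, 'm) funct \<Rightarrow> 'o \<Rightarrow> ('i \<Rightarrow> 'm) \<Rightarrow> bool" where
  "is_cocone J C T L \<iota> \<longleftrightarrow> L \<in> Obj C \<and> (\<forall>i\<in>Obj J. \<iota> i \<in> Hom C (OMap T i) L) \<and>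
     (\<forall>f\<in>Arr J. \<iota> (Cod J f) \<cdot>\<^bsub>C\<^esub> AMap T f = \<iota> (Dom J f))"

definition is_colimit ::
  "('i, 'j) cat \<Rightarrow> ('o, 'm) cat \<Rightarrow> ('i, 'j, 'o, 'm) funct \<Rightarrow> 'o \<Rightarrow> ('i \<Rightarrow> 'm) \<Rightarrow> bool" where
  "is_colimit J C T L \<iota> \<longleftrightarrow> is_cocone J C T L \<iota> \<and>
     (\<forall>M \<mu>. is_cocone J C T M \<mu> \<longrightarrow>
        (\<exists>!u. u \<in> Hom C L M \<and> (\<forall>i\<in>Obj J. u \<cdot>\<^bsub>C\<^esub> \<iota> i = \<mu> i)))"

definition preserves_limits_of_shape ::
  "('i, 'j) cat \<Rightarrow> ('a, 'b) cat \<Rightarrow> ('c, 'd) cat \<Rightarrow> ('a, 'b, 'c, 'd) funct \<Rightarrow> bool" where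
  "preserves_limits_of_shape J C D F \<longleftrightarrow>
     (\<forall>T L \<pi>. is_functor J C T \<and> is_limit J C T L \<pi>
        \<longrightarrow> is_limit J D (F \<circ>\<^sub>F T) (OMap F L) (\<lambda>i. AMap F (\<pi> i)))"

definition preserves_colimits_of_shape ::
  "('i, 'j) cat \<Rightarrow> ('a, 'b) cat \<Rightarrow> ('c, 'd) cat \<Rightarrow> ('a, 'b, 'c, 'd) funct \<Rightarrow> bool" where
  "preserves_colimits_of_shape J C D F \<longleftrightarrow>
     (\<forall>T L \<iota>. is_functor J C T \<and> is_colimit J C T L \<iota>
        \<longrightarrow> is_colimit J D (F \<circ>\<^sub>F T) (OMap F L) (\<lambda>i. AMap F (\<iota> i)))"


section \<open>Products, initial and final objects, kernels\<close>

definition is_product ::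
  "'k set \<Rightarrow> ('o, 'm) cat \<Rightarrow> ('k \<Rightarrow> 'o) \<Rightarrow> 'o \<Rightarrow> ('k \<Rightarrow> 'm) \<Rightarrow> bool" where
  "is_product I C X P p \<longleftrightarrow>
     (\<forall>i\<in>I. X i \<in> Obj C) \<and> P \<in> Obj C \<and> (\<forall>i\<in>I. p i \<in> Hom C P (X i)) \<and>
     (\<forall>Q q. Q \<in> Obj C \<and> (\<forall>i\<in>I. q i \<in> Hom C Q (X i)) \<longrightarrow>
        (\<exists>!u. u \<in> Hom C Q P \<and> (\<forall>i\<in>I. p i \<cdot>\<^bsub>C\<^esub> u = q i)))"

definition is_coproduct ::
  "'k set \<Rightarrow> ('o, 'm) cat \<Rightarrow> ('k \<Rightarrow> 'o) \<Rightarrow> 'o \<Rightarrow> ('k \<Rightarrow> 'm) \<Rightarrow> bool" where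
  "is_coproduct I C X P \<iota> \<longleftrightarrow>
     (\<forall>i\<in>I. X i \<in> Obj C) \<and> P \<in> Obj C \<and> (\<forall>i\<in>I. \<iota> i \<in> Hom C (X i) P) \<and>
     (\<forall>Q q. Q \<in> Obj C \<and> (\<forall>i\<in>I. q i \<in> Hom C (X i) Q) \<longrightarrow>
        (\<exists>!u. u \<in> Hom C P Q \<and> (\<forall>i\<in>I. u \<cdot>\<^bsub>C\<^esub> \<iota> i = q i)))"

definition preserves_products_over ::
  "'k set \<Rightarrow> ('a, 'b) cat \<Rightarrow> ('c, 'd) cat \<Rightarrow> ('a, 'b, 'c, 'd) funct \<Rightarrow> bool" where
  "preserves_products_over I C D F \<longleftrightarrow>
     (\<forall>X P p. is_product I C X P p
        \<longrightarrow> is_product I D (\<lambda>i. OMap F (X i)) (OMap F P) (\<lambda>i. AMap F (p i)))"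

definition preserves_coproducts_over ::
  "'k set \<Rightarrow> ('a, 'b) cat \<Rightarrow> ('c, 'd) cat \<Rightarrow> ('a, 'b, 'c, 'd) funct \<Rightarrow> bool" where
  "preserves_coproducts_over I C D F \<longleftrightarrow>
     (\<forall>X P \<iota>. is_coproduct I C X P \<iota>
        \<longrightarrow> is_coproduct I D (\<lambda>i. OMap F (X i)) (OMap F P) (\<lambda>i. AMap F (\<iota> i)))"

definition is_initial :: "('o, 'm) cat \<Rightarrow> 'o \<Rightarrow> bool" where
  "is_initial C z \<longleftrightarrow> z \<in> Obj C \<and> (\<forall>a\<in>Obj C. \<exists>!f. f \<in> Hom C z a)"

definition is_final :: "('o, 'm) cat \<Rightarrow> 'o \<Rightarrow> bool" where
  "is_final C z \<longleftrightarrow> z \<in> Obj C \<and> (\<forall>a\<in>Obj C. \<exists>!f. f \<in> Hom C a z)"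

definition preserves_initial ::
  "('a, 'b) cat \<Rightarrow> ('c, 'd) cat \<Rightarrow> ('a, 'b, 'c, 'd) funct \<Rightarrow> bool" where
  "preserves_initial C D F \<longleftrightarrow> (\<forall>z. is_initial C z \<longrightarrow> is_initial D (OMap F z))"

definition preserves_final ::
  "('a, 'b) cat \<Rightarrow> ('c, 'd) cat \<Rightarrow> ('a, 'b, 'c, 'd) funct \<Rightarrow> bool" where
  "preserves_final C D F \<longleftrightarrow> (\<forall>z. is_final C z \<longrightarrow> is_final D (OMap F z))"

text \<open>A system of zero morphisms \<open>z a b : a \<rightarrow> b\<close>. If one exists it is unique on the objects of \<open>C\<close>;
  every category with a zero object and every preadditive category has one. Kernels and cokernels
  only make sense relative to zero morphisms, so \<open>is_kernel\<close> and \<open>is_cokernel\<close> include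
  their existence.\<close>

definition zero_morphisms :: "('o, 'm) cat \<Rightarrow> ('o \<Rightarrow> 'o \<Rightarrow> 'm) \<Rightarrow> bool" where
  "zero_morphisms C z \<longleftrightarrow>
     (\<forall>a\<in>Obj C. \<forall>b\<in>Obj C. z a b \<in> Hom C a b) \<and>
     (\<forall>a\<in>Obj C. \<forall>b\<in>Obj C. \<forall>c\<in>Obj C. \<forall>f\<in>Hom C a b. z b c \<cdot>\<^bsub>C\<^esub> f = z a c) \<and>
     (\<forall>a\<in>Obj C. \<forall>b\<in>Obj C. \<forall>c\<in>Obj C. \<forall>g\<in>Hom C b c. g \<cdot>\<^bsub>C\<^esub> z a b = z a c)"

definition is_kernel :: "('o, 'm) cat \<Rightarrow> 'm \<Rightarrow> 'm \<Rightarrow> bool" where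
  "is_kernel C k f \<longleftrightarrow> (\<exists>z. zero_morphisms C z \<and> f \<in> Arr C \<and> k \<in> Arr C \<and> Cod C k = Dom C f \<and>
     f \<cdot>\<^bsub>C\<^esub> k = z (Dom C k) (Cod C f) \<and>
     (\<forall>h\<in>Arr C. Cod C h = Dom C f \<and> f \<cdot>\<^bsub>C\<^esub> h = z (Dom C h) (Cod C f) \<longrightarrow>
        (\<exists>!u. u \<in> Hom C (Dom C h) (Dom C k) \<and> k \<cdot>\<^bsub>C\<^esub> u = h)))"

definition is_cokernel :: "('o, 'm) cat \<Rightarrow> 'm \<Rightarrow> 'm \<Rightarrow> bool" where
  "is_cokernel C q f \<longleftrightarrow> (\<exists>z. zero_morphisms C z \<and> f \<in> Arr C \<and> q \<in> Arr C \<and> Dom C q = Cod C f \<and>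
     q \<cdot>\<^bsub>C\<^esub> f = z (Dom C f) (Cod C q) \<and>
     (\<forall>h\<in>Arr C. Dom C h = Cod C f \<and> h \<cdot>\<^bsub>C\<^esub> f = z (Dom C f) (Cod C h) \<longrightarrow>
        (\<exists>!u. u \<in> Hom C (Cod C q) (Cod C h) \<and> u \<cdot>\<^bsub>C\<^esub> q = h)))"

definition preserves_kernels ::
  "('a, 'b) cat \<Rightarrow> ('c, 'd) cat \<Rightarrow> ('a, 'b, 'c, 'd) funct \<Rightarrow> bool" where
  "preserves_kernels C D F \<longleftrightarrow> (\<forall>k f. is_kernel C k f \<longrightarrow> is_kernel D (AMap F k) (AMap F f))"

definition preserves_cokernels ::
  "('a, 'b) cat \<Rightarrow> ('c, 'd) cat \<Rightarrow> ('a, 'b, 'c, 'd) funct \<Rightarrow> bool" where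
  "preserves_cokernels C D F \<longleftrightarrow>
     (\<forall>q f. is_cokernel C q f \<longrightarrow> is_cokernel D (AMap F q) (AMap F f))"


section \<open>Abelian categories\<close>

definition is_mono :: "('o, 'm) cat \<Rightarrow> 'm \<Rightarrow> bool" where
  "is_mono C f \<longleftrightarrow> f \<in> Arr C \<and>
     (\<forall>w. \<forall>u\<in>Hom C w (Dom C f). \<forall>v\<in>Hom C w (Dom C f). f \<cdot>\<^bsub>C\<^esub> u = f \<cdot>\<^bsub>C\<^esub> v \<longrightarrow> u = v)"

definition is_epi :: "('o, 'm) cat \<Rightarrow> 'm \<Rightarrow> bool" where
  "is_epi C f \<longleftrightarrow> f \<in> Arr C \<and>
     (\<forall>w. \<forall>u\<in>Hom C (Cod C f) w. \<forall>v\<in>Hom C (Cod C f) w. u \<cdot>\<^bsub>C\<^esub> f = v \<cdot>\<^bsub>C\<^esub> f \<longrightarrow> u = v)"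

definition preadditive :: "('o, 'm) cat \<Rightarrow> ('m \<Rightarrow> 'm \<Rightarrow> 'm) \<Rightarrow> bool" where
  "preadditive C add \<longleftrightarrow> category C \<and>
     (\<forall>a\<in>Obj C. \<forall>b\<in>Obj C. \<exists>z. comm_group \<lparr>carrier = Hom C a b, monoid.mult = add, one = z\<rparr>) \<and>
     (\<forall>a b c. \<forall>f\<in>Hom C a b. \<forall>f'\<in>Hom C a b. \<forall>g\<in>Hom C b c.
        g \<cdot>\<^bsub>C\<^esub> (add f f') = add (g \<cdot>\<^bsub>C\<^esub> f) (g \<cdot>\<^bsub>C\<^esub> f')) \<and>
     (\<forall>a b c. \<forall>f\<in>Hom C a b. \<forall>g\<in>Hom C b c. \<forall>g'\<in>Hom C b c.
        (add g g') \<cdot>\<^bsub>C\<^esub> f = add (g \<cdot>\<^bsub>C\<^esub> f) (g' \<cdot>\<^bsub>C\<^esub> f))"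

text \<open>Additive: preadditive with a zero object and binary products (these are then biproducts).
  Abelian: additive, every morphism has a kernel and a cokernel, every monomorphism is
  the kernel of its cokernel, every epimorphism is the cokernel of its kernel.\<close>

definition additive :: "('o, 'm) cat \<Rightarrow> ('m \<Rightarrow> 'm \<Rightarrow> 'm) \<Rightarrow> bool" where
  "additive C add \<longleftrightarrow> preadditive C add \<and>
     (\<exists>z. is_initial C z \<and> is_final C z) \<and>
     (\<forall>X. (\<forall>i. X i \<in> Obj C) \<longrightarrow> (\<exists>P p. is_product (UNIV :: bool set) C X P p))"

definition abelian :: "('o, 'm) cat \<Rightarrow> ('m \<Rightarrow> 'm \<Rightarrow> 'm) \<Rightarrow> bool" where
  "abelian C add \<longleftrightarrow> additive C add \<and>
     (\<forall>f\<in>Arr C. (\<exists>k. is_kernel C k f) \<and> (\<exists>q. is_cokernel C q f)) \<and>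
     (\<forall>f. is_mono C f \<longrightarrow> (\<forall>q. is_cokernel C q f \<longrightarrow> is_kernel C f q)) \<and>
     (\<forall>f. is_epi C f \<longrightarrow> (\<forall>k. is_kernel C k f \<longrightarrow> is_cokernel C f k))"

definition additive_functor ::
  "('a, 'b) cat \<Rightarrow> ('b \<Rightarrow> 'b \<Rightarrow> 'b) \<Rightarrow> ('d \<Rightarrow> 'd \<Rightarrow> 'd)
    \<Rightarrow> ('a, 'b, 'c, 'd) funct \<Rightarrow> bool" where
  "additive_functor C addC addD F \<longleftrightarrow>
     (\<forall>a b. \<forall>f\<in>Hom C a b. \<forall>g\<in>Hom C a b. AMap F (addC f g) = addD (AMap F f) (AMap F g))"

text \<open>The image of \<open>f\<close> is the kernel of its cokernel; \<open>a \<rightarrow> b \<rightarrow> c\<close> is exact at \<open>b\<close> if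
  the image of the first morphism is the kernel of the second (as subobjects of \<open>b\<close>).\<close>

definition is_image :: "('o, 'm) cat \<Rightarrow> 'm \<Rightarrow> 'm \<Rightarrow> bool" where
  "is_image C m f \<longleftrightarrow> (\<exists>q. is_cokernel C q f \<and> is_kernel C m q)"

definition exact_at :: "('o, 'm) cat \<Rightarrow> 'm \<Rightarrow> 'm \<Rightarrow> bool" where
  "exact_at C f g \<longleftrightarrow> f \<in> Arr C \<and> g \<in> Arr C \<and> Cod C f = Dom C g \<and>
     (\<exists>m. is_image C m f \<and> is_kernel C m g)"

definition exact_functor ::
  "('a, 'b) cat \<Rightarrow> ('b \<Rightarrow> 'b \<Rightarrow> 'b) \<Rightarrow> ('c, 'd) cat \<Rightarrow> ('d \<Rightarrow> 'd \<Rightarrow> 'd)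
    \<Rightarrow> ('a, 'b, 'c, 'd) funct \<Rightarrow> bool" where
  "exact_functor C addC D addD F \<longleftrightarrow> is_functor C D F \<and> additive_functor C addC addD F \<and>
     (\<forall>f g. exact_at C f g \<longrightarrow> exact_at D (AMap F f) (AMap F g))"

definition is_injective :: "('o, 'm) cat \<Rightarrow> 'o \<Rightarrow> bool" where
  "is_injective C x \<longleftrightarrow> x \<in> Obj C \<and>
     (\<forall>m. is_mono C m \<longrightarrow> (\<forall>f \<in> Hom C (Dom C m) x. \<exists>g \<in> Hom C (Cod C m) x. g \<cdot>\<^bsub>C\<^esub> m = f))"

definition is_projective :: "('o, 'm) cat \<Rightarrow> 'o \<Rightarrow> bool" where
  "is_projective C x \<longleftrightarrow> x \<in> Obj C \<and>
     (\<forall>e. is_epi C e \<longrightarrow> (\<forall>f \<in> Hom C x (Cod C e). \<exists>g \<in> Hom C x (Dom C e). e \<cdot>\<^bsub>C\<^esub> g = f))"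

definition preserves_injectives ::
  "('a, 'b) cat \<Rightarrow> ('c, 'd) cat \<Rightarrow> ('a, 'b, 'c, 'd) funct \<Rightarrow> bool" where
  "preserves_injectives C D F \<longleftrightarrow> (\<forall>x. is_injective C x \<longrightarrow> is_injective D (OMap F x))"

definition preserves_projectives ::
  "('a, 'b) cat \<Rightarrow> ('c, 'd) cat \<Rightarrow> ('a, 'b, 'c, 'd) funct \<Rightarrow> bool" where
  "preserves_projectives C D F \<longleftrightarrow> (\<forall>x. is_projective C x \<longrightarrow> is_projective D (OMap F x))"

end

theory Submission
  imports Defs
begin

text \<open>With \<open>G\<close> left adjoint to \<open>\<beta>F\<alpha>\<close>, the functor \<open>F\<close> is right adjoint to \<open>\<alpha>G\<beta>\<close>, so both \<open>F\<close>
  and \<open>G\<close> are adjoint on both sides. Right adjointness of \<open>F\<close> is only needed in the form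
  ``every object has a universal arrow to \<open>F\<close>'', which passes from \<open>\<beta>F\<alpha>\<close> to \<open>F\<close> because
  equivalences are fully faithful and essentially surjective; no left adjoint has to be chosen.
  Preservation of limits, kernels and sums of morphisms follows, and everything about colimits
  follows by passing to opposite categories. That \<open>F\<close> preserves injectives is seen on \<open>\<beta>F\<alpha>\<close>,
  a right adjoint of the mono-preserving \<open>G\<close>, since equivalences reflect injectives.\<close>

section \<open>Duality\<close>

text \<open>Reversing twice gives back the same record. A functor is a pair of maps that does not
  mention its source and target, so the same \<open>F\<close> serves between the opposites.\<close>

definition op_cat :: "('o, 'm) cat \<Rightarrow> ('o, 'm) cat" where
  "op_cat C = \<lparr>Obj = Obj C, Arr = Arr C, Dom = Cod C, Cod = Dom C, Ident = Ident C,
     Comp = (\<lambda>g f. f \<cdot>\<^bsub>C\<^esub> g)\<rparr>"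

lemma op_cat_simps [simp]:
  "Obj (op_cat C) = Obj C" "Arr (op_cat C) = Arr C"
  "Dom (op_cat C) = Cod C" "Cod (op_cat C) = Dom C" "Ident (op_cat C) = Ident C"
  "g \<cdot>\<^bsub>op_cat C\<^esub> f = f \<cdot>\<^bsub>C\<^esub> g"
  by (simp_all add: op_cat_def)

lemma Hom_op_cat [simp]: "Hom (op_cat C) a b = Hom C b a"
  by (auto simp: Hom_def)

lemma op_cat_op_cat [simp]: "op_cat (op_cat C) = C"
  by (simp add: op_cat_def)

lemma category_op_cat: "category C \<Longrightarrow> category (op_cat C)"
  by (unfold_locales)
    (auto simp: category.Dom_in_Obj category.Cod_in_Obj category.Ident_in_Hom category.Comp_in_Hom
      category.Comp_Ident category.Ident_Comp category.Comp_assoc)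

lemma is_functor_op_cat:
  assumes "is_functor C D F"
  shows "is_functor (op_cat C) (op_cat D) F"
proof -
  interpret is_functor C D F by fact
  show ?thesis
    by (intro is_functor.intro is_functor_axioms.intro category_op_cat
        source.category_axioms target.category_axioms)
      (auto simp: OMap_in_Obj AMap_in_Hom AMap_Ident AMap_Comp)
qed

lemma is_functor_op_cat_iff [simp]:
  "is_functor (op_cat C) (op_cat D) F \<longleftrightarrow> is_functor C D F"
  using is_functor_op_cat[of "op_cat C" "op_cat D" F] is_functor_op_cat[of C D F] by auto

text \<open>Reversal swaps unit and counit, and with them the two triangle identities.\<close>

lemma adjoint_op_cat:
  assumes "adjoint C D F G"
  shows "adjoint (op_cat D) (op_cat C) G F"
proof -
  obtain \<eta> \<epsilon> where
    "nat_trans C C id_funct (G \<circ>\<^sub>F F) \<eta>" "nat_trans D D (F \<circ>\<^sub>F G) id_funct \<epsilon>"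
    "\<forall>c\<in>Obj C. \<epsilon> (OMap F c) \<cdot>\<^bsub>D\<^esub> AMap F (\<eta> c) = Ident D (OMap F c)"
    "\<forall>d\<in>Obj D. AMap G (\<epsilon> d) \<cdot>\<^bsub>C\<^esub> \<eta> (OMap G d) = Ident C (OMap G d)"
    using assms unfolding adjoint_def by blast
  then show ?thesis
    using assms unfolding adjoint_def
    by (auto intro!: exI[of _ \<epsilon>] exI[of _ \<eta>] simp: nat_trans_def)
qed

section \<open>Dual pairs of preservation properties\<close>

lemma preserves_limits_of_shape_op_cat:
  "preserves_limits_of_shape (op_cat J) (op_cat C) (op_cat D) F
    \<longleftrightarrow> preserves_colimits_of_shape J C D F"
  by (simp add: preserves_limits_of_shape_def preserves_colimits_of_shape_def
      is_limit_def is_colimit_def is_cone_def is_cocone_def)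

lemma preserves_products_over_op_cat:
  "preserves_products_over I (op_cat C) (op_cat D) F \<longleftrightarrow> preserves_coproducts_over I C D F"
  by (simp add: preserves_products_over_def preserves_coproducts_over_def
      is_product_def is_coproduct_def)

lemma preserves_final_op_cat:
  "preserves_final (op_cat C) (op_cat D) F \<longleftrightarrow> preserves_initial C D F"
  by (simp add: preserves_final_def preserves_initial_def is_final_def is_initial_def)

lemma zero_morphisms_op_cat:
  "zero_morphisms (op_cat C) z \<longleftrightarrow> zero_morphisms C (\<lambda>a b. z b a)"
  by (auto simp: zero_morphisms_def)

lemma is_kernel_op_cat: "is_kernel (op_cat C) q f \<longleftrightarrow> is_cokernel C q f"
proof -
  \<comment> \<open>Kernels and cokernels quantify existentially over the zero system, whose two
    arguments are exchanged by reversal. The exchange is an involution, so the witness can be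
    flipped.\<close>
  have swap: "(\<exists>z. P z) \<longleftrightarrow> (\<exists>z. P (\<lambda>a b. z b a))" for P :: "('a \<Rightarrow> 'a \<Rightarrow> 'b) \<Rightarrow> bool"
  proof
    assume "\<exists>z. P z"
    then obtain z where "P z" ..
    then show "\<exists>z. P (\<lambda>a b. z b a)" by (intro exI[of _ "\<lambda>a b. z b a"])
  qed blast
  show ?thesis
    unfolding is_kernel_def is_cokernel_def zero_morphisms_op_cat
    by (subst swap) simp
qed

lemma preserves_kernels_op_cat:
  "preserves_kernels (op_cat C) (op_cat D) F \<longleftrightarrow> preserves_cokernels C D F"
  by (simp add: preserves_kernels_def preserves_cokernels_def is_kernel_op_cat)

lemma is_mono_op_cat: "is_mono (op_cat C) f \<longleftrightarrow> is_epi C f"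
  by (auto simp: is_mono_def is_epi_def)

lemma is_injective_op_cat: "is_injective (op_cat C) x \<longleftrightarrow> is_projective C x"
  by (auto simp: is_injective_def is_projective_def is_mono_op_cat)

lemma preserves_injectives_op_cat:
  "preserves_injectives (op_cat C) (op_cat D) F \<longleftrightarrow> preserves_projectives C D F"
  by (simp add: preserves_injectives_def preserves_projectives_def is_injective_op_cat)


section \<open>Functors with universal arrows\<close>

lemma comp_funct_simps [simp]:
  "OMap (G \<circ>\<^sub>F F) a = OMap G (OMap F a)" "AMap (G \<circ>\<^sub>F F) f = AMap G (AMap F f)"
  by (simp_all add: comp_funct_def)

lemma Hom_Arr: "f \<in> Hom C a b \<Longrightarrow> f \<in> Arr C"
  and Hom_Dom: "f \<in> Hom C a b \<Longrightarrow> Dom C f = a"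
  and Hom_Cod: "f \<in> Hom C a b \<Longrightarrow> Cod C f = b"
  by (simp_all add: Hom_def)

lemma Arr_Hom: "f \<in> Arr C \<Longrightarrow> f \<in> Hom C (Dom C f) (Cod C f)"
  by (simp add: Hom_def)

lemma (in category) Hom_Obj:
  assumes "f \<in> Hom C a b"
  shows "a \<in> Obj C" "b \<in> Obj C"
  using assms Dom_in_Obj Cod_in_Obj by (auto simp: Hom_def)

text \<open>An initial object of the comma category of arrows from \<open>d\<close> to values of
  \<open>F\<close>: the value at \<open>d\<close> of a left adjoint, with \<open>u\<close> as unit,
  for one object at a time.\<close>

definition universal_arrow ::
  "('a, 'b) cat \<Rightarrow> ('c, 'd) cat \<Rightarrow> ('a, 'b, 'c, 'd) funct \<Rightarrow> 'c \<Rightarrow> 'a \<Rightarrow> 'd \<Rightarrow> bool" where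
  "universal_arrow C D F d c u \<longleftrightarrow> c \<in> Obj C \<and> u \<in> Hom D d (OMap F c) \<and>
     (\<forall>c'\<in>Obj C. \<forall>f\<in>Hom D d (OMap F c'). \<exists>!g. g \<in> Hom C c c' \<and> AMap F g \<cdot>\<^bsub>D\<^esub> u = f)"

locale right_adjoint_functor = is_functor C D F
  for C :: "('a, 'b) cat" and D :: "('c, 'd) cat" and F :: "('a, 'b, 'c, 'd) funct" +
  assumes universal: "d \<in> Obj D \<Longrightarrow> \<exists>c u. universal_arrow C D F d c u"

text \<open>Over the opposite categories a universal arrow is an arrow
  \<open>F c \<rightarrow> d\<close> of \<open>D\<close> through which every arrow
  \<open>F c' \<rightarrow> d\<close> factors by a unique \<open>c' \<rightarrow> c\<close>: the
  counit of a right adjoint.\<close>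

abbreviation left_adjoint_functor ::
  "('a, 'b) cat \<Rightarrow> ('c, 'd) cat \<Rightarrow> ('a, 'b, 'c, 'd) funct \<Rightarrow> bool" where
  "left_adjoint_functor C D F \<equiv> right_adjoint_functor (op_cat C) (op_cat D) F"

context is_functor
begin

text \<open>Naturality of transposition: for universal \<open>u\<close>, if \<open>f\<close> is the
  transpose of an arrow \<open>x\<close>, then \<open>g \<cdot> f\<close> is the transpose of
  \<open>F g \<cdot> x\<close>.\<close>

lemma comp_universal:
  assumes "u \<in> Hom D d (OMap F a)" "f \<in> Hom C a b" "g \<in> Hom C b c"
  shows "AMap F (g \<cdot>\<^bsub>C\<^esub> f) \<cdot>\<^bsub>D\<^esub> u = AMap F g \<cdot>\<^bsub>D\<^esub> (AMap F f \<cdot>\<^bsub>D\<^esub> u)"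
  by (simp add: AMap_Comp[OF assms(2,3)]
      target.Comp_assoc[OF assms(1) AMap_in_Hom[OF assms(2)] AMap_in_Hom[OF assms(3)]])

lemma transpose_exists:
  assumes "universal_arrow C D F d c u" "f \<in> Hom D d (OMap F c')" "c' \<in> Obj C"
  obtains g where "g \<in> Hom C c c'" "AMap F g \<cdot>\<^bsub>D\<^esub> u = f"
  using assms unfolding universal_arrow_def by blast

text \<open>The tool for proving equations in \<open>C\<close>: compare the images under
  \<open>F\<close> after composing with \<open>u\<close>.\<close>

lemma transpose_unique:
  assumes "universal_arrow C D F d c u" "g \<in> Hom C c c'" "h \<in> Hom C c c'"
    and "AMap F g \<cdot>\<^bsub>D\<^esub> u = AMap F h \<cdot>\<^bsub>D\<^esub> u"
  shows "g = h"
proof -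
  have "AMap F h \<cdot>\<^bsub>D\<^esub> u \<in> Hom D d (OMap F c')"
    using assms(1,3) target.Comp_in_Hom AMap_in_Hom unfolding universal_arrow_def by metis
  then show ?thesis
    using assms source.Hom_Obj(2)[OF assms(2)] unfolding universal_arrow_def by blast
qed

end

text \<open>The unit \<open>\<eta> c\<close> is universal from \<open>c\<close> to \<open>G\<close>:
  the transpose of \<open>f\<close> is \<open>\<epsilon> d \<cdot> F f\<close>.\<close>

lemma adjoint_right_adjoint_functor:
  assumes "adjoint C D F G"
  shows "right_adjoint_functor D C G"
proof -
  obtain \<eta> \<epsilon> where F: "is_functor C D F" and G: "is_functor D C G"
    and eta: "nat_trans C C id_funct (G \<circ>\<^sub>F F) \<eta>" and eps: "nat_trans D D (F \<circ>\<^sub>F G) id_funct \<epsilon>"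
    and tri1: "\<And>c. c\<in>Obj C \<Longrightarrow> \<epsilon> (OMap F c) \<cdot>\<^bsub>D\<^esub> AMap F (\<eta> c) = Ident D (OMap F c)"
    and tri2: "\<And>d. d\<in>Obj D \<Longrightarrow> AMap G (\<epsilon> d) \<cdot>\<^bsub>C\<^esub> \<eta> (OMap G d) = Ident C (OMap G d)"
    using assms unfolding adjoint_def by blast
  interpret F: is_functor C D F by fact
  interpret G: is_functor D C G by fact
  have etaH: "\<eta> c \<in> Hom C c (OMap G (OMap F c))" if "c \<in> Obj C" for c
    using eta that by (simp add: nat_trans_def id_funct_def)
  have epsH: "\<epsilon> d \<in> Hom D (OMap F (OMap G d)) d" if "d \<in> Obj D" for d
    using eps that by (simp add: nat_trans_def id_funct_def)
  have eta_nat: "AMap G (AMap F f) \<cdot>\<^bsub>C\<^esub> \<eta> a = \<eta> b \<cdot>\<^bsub>C\<^esub> f" if "f \<in> Hom C a b" for f a b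
    using eta that by (auto simp: nat_trans_def id_funct_def Hom_def)
  have eps_nat: "f \<cdot>\<^bsub>D\<^esub> \<epsilon> a = \<epsilon> b \<cdot>\<^bsub>D\<^esub> AMap F (AMap G f)" if "f \<in> Hom D a b" for f a b
    using eps that by (auto simp: nat_trans_def id_funct_def Hom_def)
  have "universal_arrow D C G c (OMap F c) (\<eta> c)" if c: "c \<in> Obj C" for c
    unfolding universal_arrow_def
  proof (intro conjI ballI ex1I)
    fix d f assume d: "d \<in> Obj D" and f: "f \<in> Hom C c (OMap G d)"
    show "\<epsilon> d \<cdot>\<^bsub>D\<^esub> AMap F f \<in> Hom D (OMap F c) d"
      using F.target.Comp_in_Hom[OF F.AMap_in_Hom[OF f] epsH[OF d]] .
    \<comment> \<open>Existence: naturality of \<open>\<eta>\<close> moves \<open>f\<close> to the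
      right end, and the triangle identity for \<open>G\<close> cancels the rest.\<close>
    have "AMap G (\<epsilon> d \<cdot>\<^bsub>D\<^esub> AMap F f) \<cdot>\<^bsub>C\<^esub> \<eta> c = AMap G (\<epsilon> d) \<cdot>\<^bsub>C\<^esub> (AMap G (AMap F f) \<cdot>\<^bsub>C\<^esub> \<eta> c)"
      using G.comp_universal etaH[OF c] F.AMap_in_Hom[OF f] epsH[OF d] by blast
    also have "\<dots> = AMap G (\<epsilon> d) \<cdot>\<^bsub>C\<^esub> (\<eta> (OMap G d) \<cdot>\<^bsub>C\<^esub> f)"
      by (simp add: eta_nat[OF f])
    also have "\<dots> = (AMap G (\<epsilon> d) \<cdot>\<^bsub>C\<^esub> \<eta> (OMap G d)) \<cdot>\<^bsub>C\<^esub> f"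
      using F.source.Comp_assoc[OF f etaH G.AMap_in_Hom[OF epsH[OF d]]] G.OMap_in_Obj[OF d] by simp
    finally show "AMap G (\<epsilon> d \<cdot>\<^bsub>D\<^esub> AMap F f) \<cdot>\<^bsub>C\<^esub> \<eta> c = f"
      by (simp add: tri2[OF d] F.source.Ident_Comp[OF f])
    fix g assume "g \<in> Hom D (OMap F c) d \<and> AMap G g \<cdot>\<^bsub>C\<^esub> \<eta> c = f"
    then have g: "g \<in> Hom D (OMap F c) d" and gf: "AMap G g \<cdot>\<^bsub>C\<^esub> \<eta> c = f" by auto
    have Fc: "OMap F c \<in> Obj D" using F.OMap_in_Obj[OF c] .
    \<comment> \<open>Uniqueness: insert the triangle identity for \<open>F\<close> and recover
      \<open>g\<close> from \<open>f\<close> by naturality of \<open>\<epsilon>\<close>.\<close>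
    have "g = g \<cdot>\<^bsub>D\<^esub> (\<epsilon> (OMap F c) \<cdot>\<^bsub>D\<^esub> AMap F (\<eta> c))"
      by (simp add: tri1[OF c] F.target.Comp_Ident[OF g])
    also have "\<dots> = (g \<cdot>\<^bsub>D\<^esub> \<epsilon> (OMap F c)) \<cdot>\<^bsub>D\<^esub> AMap F (\<eta> c)"
      using F.target.Comp_assoc[OF F.AMap_in_Hom[OF etaH[OF c]] epsH[OF Fc] g] by simp
    also have "\<dots> = \<epsilon> d \<cdot>\<^bsub>D\<^esub> (AMap F (AMap G g) \<cdot>\<^bsub>D\<^esub> AMap F (\<eta> c))"
      using F.target.Comp_assoc[OF F.AMap_in_Hom[OF etaH[OF c]]
          F.AMap_in_Hom[OF G.AMap_in_Hom[OF g]] epsH[OF d]]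
      by (simp add: eps_nat[OF g])
    also have "\<dots> = \<epsilon> d \<cdot>\<^bsub>D\<^esub> AMap F f"
      by (simp add: gf[symmetric] F.AMap_Comp[OF etaH[OF c] G.AMap_in_Hom[OF g]])
    finally show "g = \<epsilon> d \<cdot>\<^bsub>D\<^esub> AMap F f" .
  qed (use c etaH F.OMap_in_Obj in auto)
  then show ?thesis
    by unfold_locales blast
qed

lemma adjoint_left_adjoint_functor: "adjoint C D F G \<Longrightarrow> left_adjoint_functor C D F"
  by (rule adjoint_right_adjoint_functor[OF adjoint_op_cat])


section \<open>Limits, products, monomorphisms\<close>

context right_adjoint_functor
begin

text \<open>A cone over \<open>F \<circ>\<^sub>F T\<close> with vertex \<open>M\<close> transposes,
  along a universal arrow from \<open>M\<close> to \<open>F\<close>, to a cone over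
  \<open>T\<close>. The image of its mediating arrow, composed with the universal arrow, mediates
  the original cone.\<close>

lemma preserves_limits: "preserves_limits_of_shape J C D F"
  unfolding preserves_limits_of_shape_def
proof (intro allI impI, elim conjE)
  fix T L \<pi> assume "is_functor J C T" and lim: "is_limit J C T L \<pi>"
  interpret T: is_functor J C T by fact
  have L: "L \<in> Obj C" and pi: "\<And>i. i \<in> Obj J \<Longrightarrow> \<pi> i \<in> Hom C L (OMap T i)"
    and pi_nat: "\<And>f. f \<in> Arr J \<Longrightarrow> AMap T f \<cdot>\<^bsub>C\<^esub> \<pi> (Dom J f) = \<pi> (Cod J f)"
    using lim by (auto simp: is_limit_def is_cone_def)
  have cone: "is_cone J D (F \<circ>\<^sub>F T) (OMap F L) (\<lambda>i. AMap F (\<pi> i))"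
    unfolding is_cone_def
  proof (intro conjI ballI)
    fix f assume f: "f \<in> Arr J"
    have "AMap F (AMap T f) \<cdot>\<^bsub>D\<^esub> AMap F (\<pi> (Dom J f)) = AMap F (AMap T f \<cdot>\<^bsub>C\<^esub> \<pi> (Dom J f))"
      using AMap_Comp[OF pi[OF T.source.Dom_in_Obj[OF f]] T.AMap_in_Hom[OF Arr_Hom[OF f]]] by simp
    then show "AMap (F \<circ>\<^sub>F T) f \<cdot>\<^bsub>D\<^esub> AMap F (\<pi> (Dom J f)) = AMap F (\<pi> (Cod J f))"
      by (simp add: pi_nat[OF f])
  qed (use L pi OMap_in_Obj AMap_in_Hom in auto)
  have "\<exists>!v. v \<in> Hom D M (OMap F L) \<and> (\<forall>i\<in>Obj J. AMap F (\<pi> i) \<cdot>\<^bsub>D\<^esub> v = \<mu> i)"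
    if cone: "is_cone J D (F \<circ>\<^sub>F T) M \<mu>" for M \<mu>
  proof -
    have M: "M \<in> Obj D" and mu: "\<And>i. i \<in> Obj J \<Longrightarrow> \<mu> i \<in> Hom D M (OMap F (OMap T i))"
      and mu_nat: "\<And>f. f \<in> Arr J \<Longrightarrow> AMap F (AMap T f) \<cdot>\<^bsub>D\<^esub> \<mu> (Dom J f) = \<mu> (Cod J f)"
      using cone by (auto simp: is_cone_def)
    obtain c u where cu: "universal_arrow C D F M c u" using universal[OF M] by blast
    then have c: "c \<in> Obj C" and u: "u \<in> Hom D M (OMap F c)" by (auto simp: universal_arrow_def)
    have "\<forall>i\<in>Obj J. \<exists>g. g \<in> Hom C c (OMap T i) \<and> AMap F g \<cdot>\<^bsub>D\<^esub> u = \<mu> i"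
      using transpose_exists[OF cu mu] T.OMap_in_Obj by metis
    then obtain \<nu> where nu: "\<And>i. i \<in> Obj J \<Longrightarrow> \<nu> i \<in> Hom C c (OMap T i)"
      and nu_mu: "\<And>i. i \<in> Obj J \<Longrightarrow> AMap F (\<nu> i) \<cdot>\<^bsub>D\<^esub> u = \<mu> i" by metis
    \<comment> \<open>The transposed legs are compatible because both sides have the same image over
      \<open>u\<close>, namely \<open>\<mu> (Cod J f)\<close>.\<close>
    have "AMap T f \<cdot>\<^bsub>C\<^esub> \<nu> (Dom J f) = \<nu> (Cod J f)" if f: "f \<in> Arr J" for f
    proof (rule transpose_unique[OF cu])
      note D = T.source.Dom_in_Obj[OF f] and E = T.source.Cod_in_Obj[OF f]
      note Tf = T.AMap_in_Hom[OF Arr_Hom[OF f]]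
      show "AMap T f \<cdot>\<^bsub>C\<^esub> \<nu> (Dom J f) \<in> Hom C c (OMap T (Cod J f))"
        using source.Comp_in_Hom[OF nu[OF D] Tf] .
      show "AMap F (AMap T f \<cdot>\<^bsub>C\<^esub> \<nu> (Dom J f)) \<cdot>\<^bsub>D\<^esub> u = AMap F (\<nu> (Cod J f)) \<cdot>\<^bsub>D\<^esub> u"
        using comp_universal[OF u nu[OF D] Tf] by (simp add: nu_mu D E mu_nat f)
      show "\<nu> (Cod J f) \<in> Hom C c (OMap T (Cod J f))" using nu[OF E] .
    qed
    then have "is_cone J C T c \<nu>" by (simp add: is_cone_def c nu)
    then have ex1: "\<exists>!v. v \<in> Hom C c L \<and> (\<forall>i\<in>Obj J. \<pi> i \<cdot>\<^bsub>C\<^esub> v = \<nu> i)"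
      using lim by (auto simp: is_limit_def)
    then obtain v where v: "v \<in> Hom C c L" and v_nu: "\<And>i. i \<in> Obj J \<Longrightarrow> \<pi> i \<cdot>\<^bsub>C\<^esub> v = \<nu> i" by blast
    show ?thesis
    proof (rule ex1I[of _ "AMap F v \<cdot>\<^bsub>D\<^esub> u"], intro conjI ballI)
      show "AMap F v \<cdot>\<^bsub>D\<^esub> u \<in> Hom D M (OMap F L)"
        using target.Comp_in_Hom[OF u AMap_in_Hom[OF v]] .
      show "AMap F (\<pi> i) \<cdot>\<^bsub>D\<^esub> (AMap F v \<cdot>\<^bsub>D\<^esub> u) = \<mu> i" if "i \<in> Obj J" for i
        using comp_universal[OF u v pi[OF that]] by (simp add: that v_nu nu_mu)
      \<comment> \<open>A competing \<open>w\<close> transposes to some \<open>w'\<close> that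
        mediates the cone \<open>\<nu>\<close>, so \<open>w' = v\<close>.\<close>
      fix w assume w: "w \<in> Hom D M (OMap F L) \<and> (\<forall>i\<in>Obj J. AMap F (\<pi> i) \<cdot>\<^bsub>D\<^esub> w = \<mu> i)"
      then obtain w' where w': "w' \<in> Hom C c L" "AMap F w' \<cdot>\<^bsub>D\<^esub> u = w"
        using transpose_exists[OF cu _ L] by blast
      have "\<pi> i \<cdot>\<^bsub>C\<^esub> w' = \<nu> i" if i: "i \<in> Obj J" for i
        using transpose_unique[OF cu source.Comp_in_Hom[OF w'(1) pi[OF i]] nu[OF i]]
          comp_universal[OF u w'(1) pi[OF i]] w i by (simp add: w'(2) nu_mu)
      then show "w = AMap F v \<cdot>\<^bsub>D\<^esub> u" using ex1 v v_nu w' by blast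
    qed
  qed
  with cone show "is_limit J D (F \<circ>\<^sub>F T) (OMap F L) (\<lambda>i. AMap F (\<pi> i))"
    unfolding is_limit_def by blast
qed

end

text \<open>Every arrow is the identity of itself as an object. Composable pairs have
  \<open>g = f\<close>, so composition may return its second argument.\<close>

definition discrete :: "'k set \<Rightarrow> ('k, 'k) cat" where
  "discrete I = \<lparr>Obj = I, Arr = I, Dom = id, Cod = id, Ident = id, Comp = (\<lambda>g f. f)\<rparr>"

lemma category_discrete: "category (discrete I)"
  by unfold_locales (auto simp: discrete_def Hom_def)

text \<open>On a diagram of identities, compatibility of a cone is an instance of the identity law,
  so cones are just families of arrows.\<close>

lemma is_limit_discrete:
  assumes "category C" and "\<And>i. i \<in> I \<Longrightarrow> OMap T i \<in> Obj C"
    and "\<And>i. i \<in> I \<Longrightarrow> AMap T i = Ident C (OMap T i)"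
  shows "is_limit (discrete I) C T P p \<longleftrightarrow> is_product I C (OMap T) P p"
proof -
  have "is_cone (discrete I) C T Q q \<longleftrightarrow> Q \<in> Obj C \<and> (\<forall>i\<in>I. q i \<in> Hom C Q (OMap T i))" for Q q
    using category.Ident_Comp[OF assms(1)] assms(3)
    by (auto simp: is_cone_def discrete_def)
  then show ?thesis
    using assms(2) by (simp add: is_limit_def is_product_def conj_assoc) (simp add: discrete_def)
qed

section \<open>Products, final objects and monomorphisms under right adjoints\<close>

context right_adjoint_functor
begin

lemma preserves_products: "preserves_products_over I C D F"
  unfolding preserves_products_over_def
proof (intro allI impI)
  fix X P p assume prod: "is_product I C X P p"
  then have X: "\<And>i. i \<in> I \<Longrightarrow> X i \<in> Obj C" by (simp add: is_product_def)
  \<comment> \<open>The family becomes a diagram by sending the only arrow at \<open>i\<close> to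
    the identity of \<open>X i\<close>.\<close>
  define T where "T = \<lparr>OMap = X, AMap = (\<lambda>i. Ident C (X i))\<rparr>"
  have T: "is_functor (discrete I) C T"
    by (intro is_functor.intro is_functor_axioms.intro category_discrete source.category_axioms)
      (use X source.Ident_in_Hom source.Comp_Ident[OF source.Ident_in_Hom] in
        \<open>auto simp: T_def discrete_def Hom_def[of "discrete I", unfolded discrete_def]\<close>)
  have "is_limit (discrete I) C T P p"
    using is_limit_discrete[OF source.category_axioms, of I T P p] X prod by (simp add: T_def)
  then have "is_limit (discrete I) D (F \<circ>\<^sub>F T) (OMap F P) (\<lambda>i. AMap F (p i))"
    using preserves_limits T unfolding preserves_limits_of_shape_def by blast
  then have "is_product I D (OMap (F \<circ>\<^sub>F T)) (OMap F P) (\<lambda>i. AMap F (p i))"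
    using is_limit_discrete[OF target.category_axioms, of I "F \<circ>\<^sub>F T" "OMap F P"]
      X OMap_in_Obj AMap_Ident by (simp add: T_def)
  moreover have "OMap (F \<circ>\<^sub>F T) = (\<lambda>i. OMap F (X i))" by (auto simp: T_def)
  ultimately show "is_product I D (\<lambda>i. OMap F (X i)) (OMap F P) (\<lambda>i. AMap F (p i))" by simp
qed

text \<open>A final object is a product over the empty index set; \<open>unit\<close> is an
  arbitrary choice of index type.\<close>

lemma preserves_final: "preserves_final C D F"
proof -
  have "is_final E z \<longleftrightarrow> is_product ({} :: unit set) E X z p" for E :: "('x, 'y) cat" and z X p
    by (auto simp: is_final_def is_product_def)
  then show ?thesis
    using preserves_products[of "{} :: unit set"]
    unfolding preserves_final_def preserves_products_over_def by metis
qed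

text \<open>Two arrows equalised by \<open>F m\<close> have transposes equalised by
  \<open>m\<close>.\<close>

lemma preserves_mono:
  assumes m: "is_mono C m"
  shows "is_mono D (AMap F m)"
  unfolding is_mono_def
proof (intro conjI allI ballI impI)
  have mA: "m \<in> Hom C (Dom C m) (Cod C m)" using m by (simp add: is_mono_def Arr_Hom)
  note Fm = AMap_in_Hom[OF mA]
  show "AMap F m \<in> Arr D" using Hom_Arr[OF Fm] .
  fix w g h assume gh: "g \<in> Hom D w (Dom D (AMap F m))" "h \<in> Hom D w (Dom D (AMap F m))"
    and eq: "AMap F m \<cdot>\<^bsub>D\<^esub> g = AMap F m \<cdot>\<^bsub>D\<^esub> h"
  have a: "Dom C m \<in> Obj C" using source.Hom_Obj[OF mA] by simp
  obtain c u where cu: "universal_arrow C D F w c u"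
    using universal target.Hom_Obj[OF gh(1)] by blast
  then have u: "u \<in> Hom D w (OMap F c)" by (simp add: universal_arrow_def)
  obtain g' where g': "g' \<in> Hom C c (Dom C m)" "AMap F g' \<cdot>\<^bsub>D\<^esub> u = g"
    using transpose_exists[OF cu _ a] gh(1) Hom_Dom[OF Fm] by metis
  obtain h' where h': "h' \<in> Hom C c (Dom C m)" "AMap F h' \<cdot>\<^bsub>D\<^esub> u = h"
    using transpose_exists[OF cu _ a] gh(2) Hom_Dom[OF Fm] by metis
  have "m \<cdot>\<^bsub>C\<^esub> g' = m \<cdot>\<^bsub>C\<^esub> h'"
    using transpose_unique[OF cu source.Comp_in_Hom[OF g'(1) mA] source.Comp_in_Hom[OF h'(1) mA]]
      comp_universal[OF u g'(1) mA] comp_universal[OF u h'(1) mA] eq g'(2) h'(2) by simp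
  then have "g' = h'" using m g'(1) h'(1) unfolding is_mono_def by blast
  then show "g = h" using g' h' by simp
qed

end

lemma left_adjoint_functor_preserves_epi:
  assumes "left_adjoint_functor C D F" "is_epi C e"
  shows "is_epi D (AMap F e)"
  using right_adjoint_functor.preserves_mono[OF assms(1)] assms(2) by (simp add: is_mono_op_cat)


section \<open>Zero morphisms, kernels, additivity\<close>

lemma zero_morphisms_in_Hom:
  "zero_morphisms C z \<Longrightarrow> a \<in> Obj C \<Longrightarrow> b \<in> Obj C \<Longrightarrow> z a b \<in> Hom C a b"
  by (simp add: zero_morphisms_def)

lemma (in category) zero_morphisms_comp_right:
  "zero_morphisms C z \<Longrightarrow> f \<in> Hom C a b \<Longrightarrow> c \<in> Obj C \<Longrightarrow> z b c \<cdot> f = z a c"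
  using Hom_Obj[of f a b] by (simp add: zero_morphisms_def)

lemma (in category) zero_morphisms_comp_left:
  "zero_morphisms C z \<Longrightarrow> g \<in> Hom C b c \<Longrightarrow> a \<in> Obj C \<Longrightarrow> g \<cdot> z a b = z a c"
  using Hom_Obj[of g b c] by (simp add: zero_morphisms_def)

context right_adjoint_functor
begin

text \<open>For universal \<open>u : F a \<rightarrow> F c\<close>, let \<open>e\<close> and
  \<open>h\<close> be the transposes of the identity and of \<open>w (F a) (F b)\<close>. Both
  \<open>z a b \<cdot> e\<close> and \<open>z b b \<cdot> h\<close> equal \<open>z c b\<close>, so
  \<open>F (z a b)\<close> equals \<open>F (z b b) \<cdot> w (F a) (F b)\<close>, which
  \<open>w\<close> absorbs.\<close>

lemma preserves_zero_morphisms: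
  assumes z: "zero_morphisms C z" and w: "zero_morphisms D w"
    and a: "a \<in> Obj C" and b: "b \<in> Obj C"
  shows "AMap F (z a b) = w (OMap F a) (OMap F b)"
proof -
  note Fa = OMap_in_Obj[OF a] and Fb = OMap_in_Obj[OF b]
  obtain c u where cu: "universal_arrow C D F (OMap F a) c u" using universal[OF Fa] by blast
  then have c: "c \<in> Obj C" and u: "u \<in> Hom D (OMap F a) (OMap F c)"
    by (auto simp: universal_arrow_def)
  obtain h where h: "h \<in> Hom C c b" "AMap F h \<cdot>\<^bsub>D\<^esub> u = w (OMap F a) (OMap F b)"
    using transpose_exists[OF cu zero_morphisms_in_Hom[OF w Fa Fb] b] by blast
  obtain e where e: "e \<in> Hom C c a" "AMap F e \<cdot>\<^bsub>D\<^esub> u = Ident D (OMap F a)"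
    using transpose_exists[OF cu target.Ident_in_Hom[OF Fa] a] by blast
  have "AMap F (z a b) = AMap F (z a b) \<cdot>\<^bsub>D\<^esub> (AMap F e \<cdot>\<^bsub>D\<^esub> u)"
    using target.Comp_Ident[OF AMap_in_Hom[OF zero_morphisms_in_Hom[OF z a b]]] e(2) by simp
  also have "\<dots> = AMap F (z c b) \<cdot>\<^bsub>D\<^esub> u"
    using comp_universal[OF u e(1) zero_morphisms_in_Hom[OF z a b]]
    by (simp add: source.zero_morphisms_comp_right[OF z e(1) b])
  also have "\<dots> = AMap F (z b b) \<cdot>\<^bsub>D\<^esub> (AMap F h \<cdot>\<^bsub>D\<^esub> u)"
    using comp_universal[OF u h(1) zero_morphisms_in_Hom[OF z b b]]
    by (simp add: source.zero_morphisms_comp_right[OF z h(1) b])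
  also have "\<dots> = w (OMap F a) (OMap F b)"
    using target.zero_morphisms_comp_left[OF w AMap_in_Hom[OF zero_morphisms_in_Hom[OF z b b]] Fa]
    by (simp add: h(2))
  finally show ?thesis .
qed

text \<open>A test arrow killed by \<open>F f\<close> transposes to one killed by \<open>f\<close>,
  factors there through \<open>k\<close>, and the factor is carried back. A zero system on
  \<open>D\<close> is assumed because \<open>is_kernel\<close> asserts one.\<close>

lemma preserves_kernel:
  assumes ker: "is_kernel C k f" and w: "zero_morphisms D w"
  shows "is_kernel D (AMap F k) (AMap F f)"
proof -
  obtain z where z: "zero_morphisms C z" and fA: "f \<in> Arr C" and kA: "k \<in> Arr C"
    and kf: "Cod C k = Dom C f" and fk: "f \<cdot>\<^bsub>C\<^esub> k = z (Dom C k) (Cod C f)"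
    and univ: "\<And>h. h \<in> Arr C \<Longrightarrow> Cod C h = Dom C f \<Longrightarrow> f \<cdot>\<^bsub>C\<^esub> h = z (Dom C h) (Cod C f) \<Longrightarrow>
      \<exists>!u. u \<in> Hom C (Dom C h) (Dom C k) \<and> k \<cdot>\<^bsub>C\<^esub> u = h"
    using ker unfolding is_kernel_def by blast
  define a b x where "a = Dom C f" and "b = Cod C f" and "x = Dom C k"
  have f: "f \<in> Hom C a b" and k: "k \<in> Hom C x a"
    using fA kA kf by (auto simp: Hom_def a_def b_def x_def)
  note a = source.Hom_Obj(1)[OF f] and b = source.Hom_Obj(2)[OF f] and x = source.Hom_Obj(1)[OF k]
  note Ff = AMap_in_Hom[OF f] and Fk = AMap_in_Hom[OF k]
  note Fb = OMap_in_Obj[OF b]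
  have zero: "AMap F f \<cdot>\<^bsub>D\<^esub> AMap F k = w (OMap F x) (OMap F b)"
    using AMap_Comp[OF k f] preserves_zero_morphisms[OF z w x b] fk by (simp add: x_def b_def)
  have fac: "\<exists>!v. v \<in> Hom D d (OMap F x) \<and> AMap F k \<cdot>\<^bsub>D\<^esub> v = h"
    if h: "h \<in> Hom D d (OMap F a)" and fh: "AMap F f \<cdot>\<^bsub>D\<^esub> h = w d (OMap F b)" for d h
  proof -
    obtain c u where cu: "universal_arrow C D F d c u"
      using universal target.Hom_Obj(1)[OF h] by blast
    then have c: "c \<in> Obj C" and u: "u \<in> Hom D d (OMap F c)" by (auto simp: universal_arrow_def)
    obtain h' where h': "h' \<in> Hom C c a" "AMap F h' \<cdot>\<^bsub>D\<^esub> u = h"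
      using transpose_exists[OF cu h a] by blast
    \<comment> \<open>Both sides are the zero arrow \<open>w d (F b)\<close>: the left by the
      assumption on \<open>h\<close>, the right because \<open>F\<close> preserves zero morphisms
      and these absorb \<open>u\<close>.\<close>
    have "AMap F (f \<cdot>\<^bsub>C\<^esub> h') \<cdot>\<^bsub>D\<^esub> u = AMap F (z c b) \<cdot>\<^bsub>D\<^esub> u"
      using comp_universal[OF u h'(1) f] target.zero_morphisms_comp_right[OF w u Fb]
      by (simp add: h'(2) fh preserves_zero_morphisms[OF z w c b])
    then have "f \<cdot>\<^bsub>C\<^esub> h' = z c b"
      by (rule transpose_unique[OF cu source.Comp_in_Hom[OF h'(1) f] zero_morphisms_in_Hom[OF z c b]])
    then have ex1: "\<exists>!v. v \<in> Hom C c x \<and> k \<cdot>\<^bsub>C\<^esub> v = h'"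
      using univ[of h'] h'(1) by (simp add: Hom_Arr[OF h'(1)] Hom_Dom[OF h'(1)] Hom_Cod[OF h'(1)]
          a_def[symmetric] b_def[symmetric] x_def[symmetric])
    then obtain v where v: "v \<in> Hom C c x" "k \<cdot>\<^bsub>C\<^esub> v = h'" by blast
    show ?thesis
    proof (rule ex1I[of _ "AMap F v \<cdot>\<^bsub>D\<^esub> u"], intro conjI)
      show "AMap F v \<cdot>\<^bsub>D\<^esub> u \<in> Hom D d (OMap F x)"
        using target.Comp_in_Hom[OF u AMap_in_Hom[OF v(1)]] .
      show "AMap F k \<cdot>\<^bsub>D\<^esub> (AMap F v \<cdot>\<^bsub>D\<^esub> u) = h"
        using comp_universal[OF u v(1) k] v(2) h'(2) by simp
      fix t assume t: "t \<in> Hom D d (OMap F x) \<and> AMap F k \<cdot>\<^bsub>D\<^esub> t = h"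
      then obtain t' where t': "t' \<in> Hom C c x" "AMap F t' \<cdot>\<^bsub>D\<^esub> u = t"
        using transpose_exists[OF cu _ x] by blast
      have "k \<cdot>\<^bsub>C\<^esub> t' = h'"
        using transpose_unique[OF cu source.Comp_in_Hom[OF t'(1) k] h'(1)]
          comp_universal[OF u t'(1) k] t t'(2) h'(2) by simp
      then show "t = AMap F v \<cdot>\<^bsub>D\<^esub> u" using ex1 v t' by blast
    qed
  qed
  show ?thesis
    unfolding is_kernel_def Hom_Dom[OF Ff] Hom_Cod[OF Ff] Hom_Dom[OF Fk] Hom_Cod[OF Fk]
  proof (intro exI[of _ w] conjI ballI impI; (elim conjE)?)
    fix h assume "h \<in> Arr D" "Cod D h = OMap F a" "AMap F f \<cdot>\<^bsub>D\<^esub> h = w (Dom D h) (OMap F b)"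
    then show "\<exists>!v. v \<in> Hom D (Dom D h) (OMap F x) \<and> AMap F k \<cdot>\<^bsub>D\<^esub> v = h"
      by (intro fac) (simp_all add: Hom_def)
  qed (use w zero Hom_Arr[OF Ff] Hom_Arr[OF Fk] in auto)
qed

end

section \<open>Addition in preadditive categories\<close>

lemma preadditive_add_closed:
  assumes "preadditive C add" "f \<in> Hom C a b" "g \<in> Hom C a b"
  shows "add f g \<in> Hom C a b"
proof -
  interpret category C using assms(1) by (simp add: preadditive_def)
  have "\<forall>a\<in>Obj C. \<forall>b\<in>Obj C. \<exists>z. comm_group \<lparr>carrier = Hom C a b, monoid.mult = add, one = z\<rparr>"
    using assms(1) by (simp add: preadditive_def)
  then obtain e where "comm_group \<lparr>carrier = Hom C a b, monoid.mult = add, one = e\<rparr>" (is "comm_group ?H")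
    using Hom_Obj[OF assms(2)] by blast
  then interpret H: comm_group ?H .
  show ?thesis using H.m_closed assms by simp
qed

lemma preadditive_comp_add:
  assumes "preadditive C add" "f \<in> Hom C a b" "f' \<in> Hom C a b" "g \<in> Hom C b c"
  shows "g \<cdot>\<^bsub>C\<^esub> add f f' = add (g \<cdot>\<^bsub>C\<^esub> f) (g \<cdot>\<^bsub>C\<^esub> f')"
proof -
  have "\<forall>a b c. \<forall>f\<in>Hom C a b. \<forall>f'\<in>Hom C a b. \<forall>g\<in>Hom C b c.
      g \<cdot>\<^bsub>C\<^esub> (add f f') = add (g \<cdot>\<^bsub>C\<^esub> f) (g \<cdot>\<^bsub>C\<^esub> f')"
    using assms(1) by (simp add: preadditive_def)
  then show ?thesis using assms(2-4) by blast
qed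

lemma preadditive_add_comp:
  assumes "preadditive C add" "f \<in> Hom C a b" "g \<in> Hom C b c" "g' \<in> Hom C b c"
  shows "add g g' \<cdot>\<^bsub>C\<^esub> f = add (g \<cdot>\<^bsub>C\<^esub> f) (g' \<cdot>\<^bsub>C\<^esub> f)"
proof -
  have "\<forall>a b c. \<forall>f\<in>Hom C a b. \<forall>g\<in>Hom C b c. \<forall>g'\<in>Hom C b c.
      (add g g') \<cdot>\<^bsub>C\<^esub> f = add (g \<cdot>\<^bsub>C\<^esub> f) (g' \<cdot>\<^bsub>C\<^esub> f)"
    using assms(1) by (simp add: preadditive_def)
  then show ?thesis using assms(2-4) by blast
qed

text \<open>The definition of \<open>preadditive\<close> provides some neutral element in each Hom
  group. By distributivity \<open>z a b\<close> is idempotent for addition, and an idempotent of a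
  group is neutral.\<close>

lemma preadditive_zero_morphisms:
  assumes pre: "preadditive C add" and z: "zero_morphisms C z" and f: "f \<in> Hom C a b"
  shows "add f (z a b) = f" "add (z a b) f = f"
proof -
  interpret category C using pre by (simp add: preadditive_def)
  note a = Hom_Obj(1)[OF f] and b = Hom_Obj(2)[OF f]
  obtain e where "comm_group \<lparr>carrier = Hom C a b, monoid.mult = add, one = e\<rparr>" (is "comm_group ?H")
    using pre a b unfolding preadditive_def by blast
  then interpret H: comm_group ?H .
  note zab = zero_morphisms_in_Hom[OF z a b]
  have "add (z b b) (z b b) \<cdot>\<^bsub>C\<^esub> z a b = add (z b b \<cdot>\<^bsub>C\<^esub> z a b) (z b b \<cdot>\<^bsub>C\<^esub> z a b)"
    using preadditive_add_comp[OF pre zab] zero_morphisms_in_Hom[OF z b b] by blast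
  moreover have "add (z b b) (z b b) \<in> Hom C b b"
    using preadditive_add_closed[OF pre] zero_morphisms_in_Hom[OF z b b] by blast
  ultimately have "add (z a b) (z a b) = z a b"
    using zero_morphisms_comp_left[OF z _ a] zero_morphisms_in_Hom[OF z b b] by simp
  then have "z a b = e"
    using H.l_cancel_one[of "z a b" "z a b"] zab by simp
  then show "add f (z a b) = f" "add (z a b) f = f"
    using H.l_one H.r_one f by simp_all
qed

text \<open>With \<open>\<delta>, j\<^sub>1, j\<^sub>2 : a \<rightarrow> a \<times> a\<close> the diagonal and the two injections and
  \<open>s = f p\<^sub>1 + g p\<^sub>2\<close>, one has \<open>f + g = s \<delta>\<close>, \<open>f = s j\<^sub>1\<close>, \<open>g = s j\<^sub>2\<close>; as \<open>F (a \<times> a)\<close> is a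
  product, \<open>F \<delta> = F j\<^sub>1 + F j\<^sub>2\<close>.\<close>

lemma (in right_adjoint_functor) additive:
  assumes addC: "additive C addC" and addD: "preadditive D addD"
    and z: "zero_morphisms C z" and w: "zero_morphisms D w"
  shows "additive_functor C addC addD F"
  unfolding additive_functor_def
proof (intro allI ballI)
  fix a b f g assume f: "f \<in> Hom C a b" and g: "g \<in> Hom C a b"
  have preC: "preadditive C addC" using addC by (simp add: additive_def)
  note distC = preadditive_add_comp[OF preC] and closC = preadditive_add_closed[OF preC]
  note distD = preadditive_comp_add[OF addD] and closD = preadditive_add_closed[OF addD]
  note a = source.Hom_Obj(1)[OF f]
  \<comment> \<open>The product \<open>P\<close> of \<open>a\<close> with itself, indexed by the two
    truth values.\<close>
  have "\<forall>X. (\<forall>i. X i \<in> Obj C) \<longrightarrow> (\<exists>P p. is_product (UNIV :: bool set) C X P p)"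
    using addC unfolding additive_def by blast
  from this[THEN spec, of "\<lambda>_. a"]
  obtain P p where P: "is_product (UNIV :: bool set) C (\<lambda>_. a) P p"
    using a by auto
  then have p: "p i \<in> Hom C P a" for i by (simp add: is_product_def)
  have pair: "\<exists>!u. u \<in> Hom C a P \<and> (\<forall>i. p i \<cdot>\<^bsub>C\<^esub> u = q i)" if "\<And>i. q i \<in> Hom C a a" for q
    using P that a by (simp add: is_product_def)
  note one = source.Ident_in_Hom[OF a] and zero = zero_morphisms_in_Hom[OF z a a]
  obtain \<delta> where d: "\<delta> \<in> Hom C a P" "\<And>i. p i \<cdot>\<^bsub>C\<^esub> \<delta> = Ident C a"
    using pair[of "\<lambda>_. Ident C a"] one by auto
  \<comment> \<open>The injections \<open>j True\<close> and \<open>j False\<close> into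
    \<open>P\<close>, given by Kronecker delta components.\<close>
  have "\<forall>k. \<exists>j. j \<in> Hom C a P \<and> (\<forall>i. p i \<cdot>\<^bsub>C\<^esub> j = (if i = k then Ident C a else z a a))"
  proof
    fix k :: bool
    have "(if i = k then Ident C a else z a a) \<in> Hom C a a" for i using one zero by simp
    from ex1_implies_ex[OF pair[OF this]]
    show "\<exists>j. j \<in> Hom C a P \<and> (\<forall>i. p i \<cdot>\<^bsub>C\<^esub> j = (if i = k then Ident C a else z a a))" .
  qed
  from choice[OF this] obtain j where j: "\<And>k. j k \<in> Hom C a P"
    "\<And>k i. p i \<cdot>\<^bsub>C\<^esub> j k = (if i = k then Ident C a else z a a)" by blast
  define s where "s = addC (f \<cdot>\<^bsub>C\<^esub> p True) (g \<cdot>\<^bsub>C\<^esub> p False)"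
  note fp = source.Comp_in_Hom[OF p[of True] f] and gp = source.Comp_in_Hom[OF p[of False] g]
  have s: "s \<in> Hom C P b" unfolding s_def by (rule closC[OF fp gp])
  have s_comp: "s \<cdot>\<^bsub>C\<^esub> r = addC (f \<cdot>\<^bsub>C\<^esub> (p True \<cdot>\<^bsub>C\<^esub> r)) (g \<cdot>\<^bsub>C\<^esub> (p False \<cdot>\<^bsub>C\<^esub> r))"
    if r: "r \<in> Hom C x P" for r x
    unfolding s_def using distC[OF r fp gp] source.Comp_assoc[OF r p f] source.Comp_assoc[OF r p g]
    by simp
  have sd: "s \<cdot>\<^bsub>C\<^esub> \<delta> = addC f g"
    using s_comp[OF d(1)] by (simp add: d(2) source.Comp_Ident[OF f] source.Comp_Ident[OF g])
  have sj: "s \<cdot>\<^bsub>C\<^esub> j True = f" "s \<cdot>\<^bsub>C\<^esub> j False = g"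
    using s_comp[OF j(1)] preadditive_zero_morphisms[OF preC z f] preadditive_zero_morphisms[OF preC z g]
      source.zero_morphisms_comp_left[OF z f a] source.zero_morphisms_comp_left[OF z g a]
    by (simp_all add: j(2) source.Comp_Ident[OF f] source.Comp_Ident[OF g])
  note Fj = AMap_in_Hom[OF j(1)]
  have FP: "is_product (UNIV :: bool set) D (\<lambda>_. OMap F a) (OMap F P) (\<lambda>i. AMap F (p i))"
    using preserves_products P unfolding preserves_products_over_def by blast
  \<comment> \<open>Componentwise the sum is identity plus zero in one order or the other, as for
    \<open>F \<delta>\<close>; the product property of \<open>F P\<close> then identifies the two
    arrows.\<close>
  have "AMap F (p i) \<cdot>\<^bsub>D\<^esub> addD (AMap F (j True)) (AMap F (j False)) = Ident D (OMap F a)" for i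
  proof -
    note FI = AMap_in_Hom[OF one, unfolded AMap_Ident[OF a]]
    have "AMap F (p i) \<cdot>\<^bsub>D\<^esub> AMap F (j k) =
        (if i = k then Ident D (OMap F a) else w (OMap F a) (OMap F a))" for k
      using AMap_Comp[OF j(1)[of k] p[of i]]
      by (cases "i = k") (simp_all add: j(2) AMap_Ident[OF a] preserves_zero_morphisms[OF z w a a])
    then show ?thesis
      using distD[OF Fj Fj AMap_in_Hom[OF p]] preadditive_zero_morphisms[OF addD w FI]
      by (cases i) simp_all
  qed
  moreover have "AMap F (p i) \<cdot>\<^bsub>D\<^esub> AMap F \<delta> = Ident D (OMap F a)" for i
    using AMap_Comp[OF d(1) p] by (simp add: d(2) AMap_Ident[OF a])
  moreover have "\<exists>!u. u \<in> Hom D (OMap F a) (OMap F P) \<and>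
      (\<forall>i. AMap F (p i) \<cdot>\<^bsub>D\<^esub> u = Ident D (OMap F a))"
  proof -
    have "\<forall>Q q. Q \<in> Obj D \<and> (\<forall>i. q i \<in> Hom D Q (OMap F a)) \<longrightarrow>
        (\<exists>!u. u \<in> Hom D Q (OMap F P) \<and> (\<forall>i. AMap F (p i) \<cdot>\<^bsub>D\<^esub> u = q i))"
      using FP by (simp add: is_product_def)
    from this[THEN spec, THEN spec, of "OMap F a" "\<lambda>_. Ident D (OMap F a)"] show ?thesis
      using OMap_in_Obj[OF a] target.Ident_in_Hom[OF OMap_in_Obj[OF a]] by simp
  qed
  ultimately have "AMap F \<delta> = addD (AMap F (j True)) (AMap F (j False))"
    using closD[OF Fj[of True] Fj[of False]] AMap_in_Hom[OF d(1)] by blast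
  \<comment> \<open>Composing with \<open>F s\<close> turns the formula for
    \<open>F \<delta>\<close> into additivity on \<open>f\<close> and \<open>g\<close>.\<close>
  then have "AMap F (addC f g) = addD (AMap F s \<cdot>\<^bsub>D\<^esub> AMap F (j True)) (AMap F s \<cdot>\<^bsub>D\<^esub> AMap F (j False))"
    using AMap_Comp[OF d(1) s] distD[OF Fj Fj AMap_in_Hom[OF s]] by (simp add: sd)
  then show "AMap F (addC f g) = addD (AMap F f) (AMap F g)"
    using AMap_Comp[OF j(1) s] by (simp add: sj[symmetric])
qed


section \<open>Functors adjoint on both sides\<close>

text \<open>The zero morphism \<open>d \<rightarrow> d'\<close> is the composite of a universal arrow \<open>d \<rightarrow> F c\<close>, the image of
  the zero morphism \<open>c \<rightarrow> c'\<close>, and a couniversal arrow \<open>F c' \<rightarrow> d'\<close>.\<close>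

lemma zero_morphisms_transfer:
  assumes R: "right_adjoint_functor C D F" and L: "left_adjoint_functor C D F"
    and z: "zero_morphisms C z"
  shows "\<exists>w. zero_morphisms D w"
proof -
  interpret R: right_adjoint_functor C D F by fact
  interpret L: right_adjoint_functor "op_cat C" "op_cat D" F by fact
  have "\<forall>d\<in>Obj D. \<exists>c u. universal_arrow C D F d c u" using R.universal by blast
  then obtain c u where cu: "\<And>d. d \<in> Obj D \<Longrightarrow> universal_arrow C D F d (c d) (u d)" by metis
  have "\<forall>d\<in>Obj D. \<exists>c u. universal_arrow (op_cat C) (op_cat D) F d c u" using L.universal by simp
  then obtain e v where
    ev: "\<And>d. d \<in> Obj D \<Longrightarrow> universal_arrow (op_cat C) (op_cat D) F d (e d) (v d)" by metis
  have c: "c d \<in> Obj C" and u: "u d \<in> Hom D d (OMap F (c d))"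
    and e: "e d \<in> Obj C" and v: "v d \<in> Hom D (OMap F (e d)) d" if "d \<in> Obj D" for d
    using cu[OF that] ev[OF that] by (auto simp: universal_arrow_def)
  note Fz = R.AMap_in_Hom[OF zero_morphisms_in_Hom[OF z]]
  define w where "w d d' = v d' \<cdot>\<^bsub>D\<^esub> (AMap F (z (c d) (e d')) \<cdot>\<^bsub>D\<^esub> u d)" for d d'
  note Fzu = R.target.Comp_in_Hom[OF u Fz[OF c]]
  have "zero_morphisms D w"
    unfolding zero_morphisms_def
  proof (intro conjI ballI)
    fix a b assume a: "a \<in> Obj D" and b: "b \<in> Obj D"
    show "w a b \<in> Hom D a b"
      unfolding w_def by (rule R.target.Comp_in_Hom[OF Fzu[OF a a e[OF b]] v[OF b]])
  next
    fix a b x f assume a: "a \<in> Obj D" and b: "b \<in> Obj D" and x: "x \<in> Obj D" and f: "f \<in> Hom D a b"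
    \<comment> \<open>\<open>h\<close> is the value at \<open>f\<close> of the left adjoint sending
      \<open>d\<close> to \<open>c d\<close>; it slides \<open>f\<close> past \<open>u\<close> so
      that \<open>z\<close> can absorb it.\<close>
    obtain h where h: "h \<in> Hom C (c a) (c b)" "AMap F h \<cdot>\<^bsub>D\<^esub> u a = u b \<cdot>\<^bsub>D\<^esub> f"
      using R.transpose_exists[OF cu[OF a] R.target.Comp_in_Hom[OF f u[OF b]] c[OF b]] .
    have "w b x \<cdot>\<^bsub>D\<^esub> f = v x \<cdot>\<^bsub>D\<^esub> (AMap F (z (c b) (e x)) \<cdot>\<^bsub>D\<^esub> (AMap F h \<cdot>\<^bsub>D\<^esub> u a))"
      unfolding w_def h(2)
      using R.target.Comp_assoc[OF f Fzu[OF b b e[OF x]] v[OF x]]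
        R.target.Comp_assoc[OF f u[OF b] Fz[OF c[OF b] e[OF x]]] by simp
    also have "\<dots> = w a x"
      unfolding w_def
      using R.comp_universal[OF u[OF a] h(1) zero_morphisms_in_Hom[OF z c[OF b] e[OF x]]]
        R.source.zero_morphisms_comp_right[OF z h(1) e[OF x]] by simp
    finally show "w b x \<cdot>\<^bsub>D\<^esub> f = w a x" .
  next
    fix a b x g assume a: "a \<in> Obj D" and b: "b \<in> Obj D" and x: "x \<in> Obj D" and g: "g \<in> Hom D b x"
    \<comment> \<open>Dually, the \<open>h\<close> obtained from this is the value at
      \<open>g\<close> of the right adjoint sending \<open>d\<close> to \<open>e d\<close>.\<close>
    have "g \<cdot>\<^bsub>D\<^esub> v b \<in> Hom (op_cat D) x (OMap F (e b))" "e b \<in> Obj (op_cat C)"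
      using R.target.Comp_in_Hom[OF v[OF b] g] e[OF b] by simp_all
    from L.transpose_exists[OF ev[OF x] this]
    obtain h where h: "h \<in> Hom C (e b) (e x)" "v x \<cdot>\<^bsub>D\<^esub> AMap F h = g \<cdot>\<^bsub>D\<^esub> v b"
      by (metis Hom_op_cat op_cat_simps(6))
    note Fh = R.AMap_in_Hom[OF h(1)]
    have "g \<cdot>\<^bsub>D\<^esub> w a b = (v x \<cdot>\<^bsub>D\<^esub> AMap F h) \<cdot>\<^bsub>D\<^esub> (AMap F (z (c a) (e b)) \<cdot>\<^bsub>D\<^esub> u a)"
      unfolding w_def h(2)
      using R.target.Comp_assoc[OF Fzu[OF a a e[OF b]] v[OF b] g] by simp
    also have "\<dots> = v x \<cdot>\<^bsub>D\<^esub> (AMap F h \<cdot>\<^bsub>D\<^esub> (AMap F (z (c a) (e b)) \<cdot>\<^bsub>D\<^esub> u a))"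
      by (rule R.target.Comp_assoc[OF Fzu[OF a a e[OF b]] Fh v[OF x]])
    also have "\<dots> = w a x"
      unfolding w_def
      using R.comp_universal[OF u[OF a] zero_morphisms_in_Hom[OF z c[OF a] e[OF b]] h(1)]
        R.source.zero_morphisms_comp_left[OF z h(1) c[OF a]] by simp
    finally show "g \<cdot>\<^bsub>D\<^esub> w a b = w a x" .
  qed
  then show ?thesis by blast
qed

text \<open>Kernels are relative to a zero system, which adjointness on both sides transfers from
  \<open>C\<close> to \<open>D\<close>.\<close>

lemma preserves_kernels_if_adjoint_both_sides:
  assumes "right_adjoint_functor C D F" "left_adjoint_functor C D F"
  shows "preserves_kernels C D F"
  unfolding preserves_kernels_def
proof (intro allI impI)
  fix k f assume k: "is_kernel C k f"
  then obtain z where "zero_morphisms C z" unfolding is_kernel_def by blast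
  then obtain w where "zero_morphisms D w" using zero_morphisms_transfer[OF assms] by blast
  then show "is_kernel D (AMap F k) (AMap F f)"
    by (rule right_adjoint_functor.preserves_kernel[OF assms(1) k])
qed

lemma preserves_cokernels_if_adjoint_both_sides:
  assumes "right_adjoint_functor C D F" "left_adjoint_functor C D F"
  shows "preserves_cokernels C D F"
  using preserves_kernels_if_adjoint_both_sides[of "op_cat C" "op_cat D" F] assms
  by (simp add: preserves_kernels_op_cat)

text \<open>The zero system is read off from a kernel of \<open>f\<close>, since
  \<open>is_kernel\<close> carries one as a witness.\<close>

lemma abelian_zero_morphisms:
  assumes "abelian C add" "f \<in> Arr C"
  obtains z where "zero_morphisms C z"
proof -
  have "\<exists>k. is_kernel C k f" using assms by (simp add: abelian_def)
  then show thesis using that unfolding is_kernel_def by blast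
qed

text \<open>Exactness is phrased through a cokernel \<open>q\<close> and a kernel \<open>m\<close>,
  and \<open>F\<close> carries these witnesses to witnesses in \<open>D\<close>.\<close>

lemma exact_functor_if_adjoint_both_sides:
  assumes R: "right_adjoint_functor C D F" and L: "left_adjoint_functor C D F"
    and C: "abelian C addC" and D: "abelian D addD"
  shows "exact_functor C addC D addD F"
proof -
  interpret right_adjoint_functor C D F by fact
  have "additive_functor C addC addD F"
  \<comment> \<open>The zero system is drawn from a kernel of some arrow; without arrows additivity
    is vacuous.\<close>
  proof (cases "Arr C = {}")
    case True
    then show ?thesis by (auto simp: additive_functor_def Hom_def)
  next
    case False
    then obtain z where z: "zero_morphisms C z" using abelian_zero_morphisms[OF C] by blast
    then obtain w where w: "zero_morphisms D w" using zero_morphisms_transfer[OF R L] by blast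
    have "additive C addC" "preadditive D addD"
      using C D by (simp_all add: abelian_def additive_def)
    then show ?thesis by (rule additive[OF _ _ z w])
  qed
  moreover have "exact_at D (AMap F f) (AMap F g)" if ex: "exact_at C f g" for f g
  proof -
    obtain m q where "is_cokernel C q f" "is_kernel C m q" "is_kernel C m g"
      and fA: "f \<in> Arr C" and gA: "g \<in> Arr C" and fg: "Cod C f = Dom C g"
      using ex unfolding exact_at_def is_image_def by blast
    then have "is_cokernel D (AMap F q) (AMap F f)" "is_kernel D (AMap F m) (AMap F q)"
      "is_kernel D (AMap F m) (AMap F g)"
      using preserves_kernels_if_adjoint_both_sides[OF R L]
        preserves_cokernels_if_adjoint_both_sides[OF R L]
      unfolding preserves_kernels_def preserves_cokernels_def by blast+
    moreover have "AMap F f \<in> Arr D" "AMap F g \<in> Arr D" "Cod D (AMap F f) = Dom D (AMap F g)"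
      using AMap_in_Hom[OF Arr_Hom[OF fA]] AMap_in_Hom[OF Arr_Hom[OF gA]] fg by (auto simp: Hom_def)
    ultimately show ?thesis unfolding exact_at_def is_image_def by blast
  qed
  ultimately show ?thesis
    unfolding exact_functor_def using is_functor_axioms by blast
qed


section \<open>Equivalences\<close>

lemma isoE:
  assumes "is_iso C f" "f \<in> Hom C a b"
  obtains g where "g \<in> Hom C b a" "g \<cdot>\<^bsub>C\<^esub> f = Ident C a" "f \<cdot>\<^bsub>C\<^esub> g = Ident C b"
  using assms unfolding is_iso_def Hom_def by auto

text \<open>Essential surjectivity supplies an isomorphism together with its inverse, which makes
  the axiom symmetric under reversal of arrows.\<close>

locale fully_faithful_ess_surj = is_functor C D F
  for C :: "('a, 'b) cat" and D :: "('c, 'd) cat" and F :: "('a, 'b, 'c, 'd) funct" +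
  assumes fully_faithful: "\<lbrakk>a \<in> Obj C; b \<in> Obj C; g \<in> Hom D (OMap F a) (OMap F b)\<rbrakk>
      \<Longrightarrow> \<exists>!f. f \<in> Hom C a b \<and> AMap F f = g"
    and ess_surj: "d \<in> Obj D \<Longrightarrow> \<exists>c\<in>Obj C. \<exists>s\<in>Hom D (OMap F c) d. \<exists>t\<in>Hom D d (OMap F c).
      t \<cdot>\<^bsub>D\<^esub> s = Ident D (OMap F c) \<and> s \<cdot>\<^bsub>D\<^esub> t = Ident D d"
begin

lemma faithful:
  assumes "f \<in> Hom C a b" "g \<in> Hom C a b" "AMap F f = AMap F g"
  shows "f = g"
  using fully_faithful[OF source.Hom_Obj[OF assms(1)] AMap_in_Hom[OF assms(1)]] assms by metis

lemma full:
  assumes "a \<in> Obj C" "b \<in> Obj C" "g \<in> Hom D (OMap F a) (OMap F b)"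
  obtains f where "f \<in> Hom C a b" "AMap F f = g"
  using fully_faithful[OF assms] by blast

text \<open>An isomorphism \<open>t : d \<rightarrow> F c\<close> is itself universal: an arrow
  \<open>f\<close> out of \<open>d\<close> corresponds to \<open>f \<cdot> s\<close> out of
  \<open>F c\<close>, which lifts uniquely to \<open>C\<close>.\<close>

lemma right_adjoint_functor: "right_adjoint_functor C D F"
proof unfold_locales
  fix d assume d: "d \<in> Obj D"
  obtain c s t where c: "c \<in> Obj C" and s: "s \<in> Hom D (OMap F c) d" and t: "t \<in> Hom D d (OMap F c)"
    and ts: "t \<cdot>\<^bsub>D\<^esub> s = Ident D (OMap F c)" and st: "s \<cdot>\<^bsub>D\<^esub> t = Ident D d"
    using ess_surj[OF d] by blast
  have "universal_arrow C D F d c t"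
    unfolding universal_arrow_def
  proof (intro conjI ballI)
    fix b f assume b: "b \<in> Obj C" and f: "f \<in> Hom D d (OMap F b)"
    note fs = target.Comp_in_Hom[OF s f]
    have "AMap F g \<cdot>\<^bsub>D\<^esub> t = f \<longleftrightarrow> AMap F g = f \<cdot>\<^bsub>D\<^esub> s" if g: "g \<in> Hom C c b" for g
      using target.Comp_assoc[OF s t AMap_in_Hom[OF g]] target.Comp_assoc[OF t s f]
        target.Comp_Ident[OF f] target.Comp_Ident[OF AMap_in_Hom[OF g]] ts st by auto
    then show "\<exists>!g. g \<in> Hom C c b \<and> AMap F g \<cdot>\<^bsub>D\<^esub> t = f"
      using fully_faithful[OF c b fs] by blast
  qed (use c t in auto)
  then show "\<exists>c u. universal_arrow C D F d c u" by blast
qed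

lemma dual: "fully_faithful_ess_surj (op_cat C) (op_cat D) F"
proof (intro fully_faithful_ess_surj.intro fully_faithful_ess_surj_axioms.intro)
  show "is_functor (op_cat C) (op_cat D) F" using is_functor_axioms by simp
  show "\<exists>c\<in>Obj (op_cat C). \<exists>s\<in>Hom (op_cat D) (OMap F c) d. \<exists>t\<in>Hom (op_cat D) d (OMap F c).
      t \<cdot>\<^bsub>op_cat D\<^esub> s = Ident (op_cat D) (OMap F c) \<and> s \<cdot>\<^bsub>op_cat D\<^esub> t = Ident (op_cat D) d"
    if "d \<in> Obj (op_cat D)" for d
    using ess_surj[of d] that by auto
qed (use fully_faithful in auto)

lemma left_adjoint_functor: "left_adjoint_functor C D F"
  by (rule fully_faithful_ess_surj.right_adjoint_functor[OF dual])

end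

text \<open>By naturality \<open>f\<close> is \<open>G (F f)\<close> conjugated by the isomorphism,
  hence determined by \<open>F f\<close>. This serves for a functor and, with the roles exchanged,
  for its quasi-inverse.\<close>

lemma faithful_if_retract:
  assumes F: "is_functor C D F" and G: "is_functor D C G"
    and iso: "nat_isomorphic C C (G \<circ>\<^sub>F F) id_funct"
    and f: "f \<in> Hom C a b" and g: "g \<in> Hom C a b" and eq: "AMap F f = AMap F g"
  shows "f = g"
proof -
  interpret F: is_functor C D F by fact
  obtain \<tau> where nat: "nat_trans C C (G \<circ>\<^sub>F F) id_funct \<tau>" and inv: "\<And>a. a \<in> Obj C \<Longrightarrow> is_iso C (\<tau> a)"
    using iso unfolding nat_isomorphic_def by blast
  note a = F.source.Hom_Obj(1)[OF f]
  have t: "\<tau> a \<in> Hom C (OMap G (OMap F a)) a" using nat a by (simp add: nat_trans_def id_funct_def)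
  have natural: "h \<cdot>\<^bsub>C\<^esub> \<tau> a = \<tau> b \<cdot>\<^bsub>C\<^esub> AMap G (AMap F h)" if "h \<in> Hom C a b" for h
    using nat that by (auto simp: nat_trans_def id_funct_def Hom_def)
  obtain s where s: "s \<in> Hom C a (OMap G (OMap F a))" "\<tau> a \<cdot>\<^bsub>C\<^esub> s = Ident C a"
    using isoE[OF inv[OF a] t] by blast
  have "h = (h \<cdot>\<^bsub>C\<^esub> \<tau> a) \<cdot>\<^bsub>C\<^esub> s" if "h \<in> Hom C a b" for h
    using F.source.Comp_assoc[OF s(1) t that] by (simp add: s(2) F.source.Comp_Ident[OF that])
  from this[OF f] this[OF g] show "f = g"
    by (simp add: natural[OF f] natural[OF g] eq)
qed

lemma equivalence_fully_faithful_ess_surj: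
  assumes "equivalence C D F"
  shows "fully_faithful_ess_surj C D F"
proof -
  obtain G where F: "is_functor C D F" and G: "is_functor D C G"
    and GF: "nat_isomorphic C C (G \<circ>\<^sub>F F) id_funct" and FG: "nat_isomorphic D D (F \<circ>\<^sub>F G) id_funct"
    using assms unfolding equivalence_def by blast
  interpret F: is_functor C D F by fact
  interpret G: is_functor D C G by fact
  obtain \<tau> where nat: "nat_trans C C (G \<circ>\<^sub>F F) id_funct \<tau>" and inv: "\<And>a. a \<in> Obj C \<Longrightarrow> is_iso C (\<tau> a)"
    using GF unfolding nat_isomorphic_def by blast
  have t: "\<tau> a \<in> Hom C (OMap G (OMap F a)) a" if "a \<in> Obj C" for a
    using nat that by (simp add: nat_trans_def id_funct_def)
  have natural: "h \<cdot>\<^bsub>C\<^esub> \<tau> a = \<tau> b \<cdot>\<^bsub>C\<^esub> AMap G (AMap F h)" if "h \<in> Hom C a b" for h a b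
    using nat that by (auto simp: nat_trans_def id_funct_def Hom_def)
  have full: "\<exists>f. f \<in> Hom C a b \<and> AMap F f = g"
    if a: "a \<in> Obj C" and b: "b \<in> Obj C" and g: "g \<in> Hom D (OMap F a) (OMap F b)" for a b g
  proof -
    obtain s where s: "s \<in> Hom C a (OMap G (OMap F a))" "s \<cdot>\<^bsub>C\<^esub> \<tau> a = Ident C (OMap G (OMap F a))"
      using isoE[OF inv[OF a] t[OF a]] by blast
    obtain r where r: "r \<in> Hom C b (OMap G (OMap F b))" "r \<cdot>\<^bsub>C\<^esub> \<tau> b = Ident C (OMap G (OMap F b))"
      using isoE[OF inv[OF b] t[OF b]] by blast
    note Gg = G.AMap_in_Hom[OF g]
    \<comment> \<open>Conjugating \<open>G g\<close> by \<open>\<tau>\<close> gives the candidate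
      preimage; naturality of \<open>\<tau>\<close> then yields
      \<open>G (F f) = G g\<close>.\<close>
    define f where "f = \<tau> b \<cdot>\<^bsub>C\<^esub> (AMap G g \<cdot>\<^bsub>C\<^esub> s)"
    note Ggs = F.source.Comp_in_Hom[OF s(1) Gg]
    have f: "f \<in> Hom C a b" unfolding f_def by (rule F.source.Comp_in_Hom[OF Ggs t[OF b]])
    note GFf = G.AMap_in_Hom[OF F.AMap_in_Hom[OF f]]
    have "\<tau> b \<cdot>\<^bsub>C\<^esub> AMap G (AMap F f) = f \<cdot>\<^bsub>C\<^esub> \<tau> a" using natural[OF f] by simp
    also have "\<dots> = \<tau> b \<cdot>\<^bsub>C\<^esub> ((AMap G g \<cdot>\<^bsub>C\<^esub> s) \<cdot>\<^bsub>C\<^esub> \<tau> a)"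
      unfolding f_def by (rule F.source.Comp_assoc[OF t[OF a] Ggs t[OF b]])
    also have "\<dots> = \<tau> b \<cdot>\<^bsub>C\<^esub> AMap G g"
      using F.source.Comp_assoc[OF t[OF a] s(1) Gg] F.source.Comp_Ident[OF Gg] s(2) by simp
    finally have "r \<cdot>\<^bsub>C\<^esub> (\<tau> b \<cdot>\<^bsub>C\<^esub> AMap G (AMap F f)) = r \<cdot>\<^bsub>C\<^esub> (\<tau> b \<cdot>\<^bsub>C\<^esub> AMap G g)" by simp
    then have "AMap G (AMap F f) = AMap G g"
      using F.source.Comp_assoc[OF GFf t[OF b] r(1)] F.source.Comp_assoc[OF Gg t[OF b] r(1)]
        F.source.Ident_Comp[OF GFf] F.source.Ident_Comp[OF Gg] r(2) by simp
    \<comment> \<open>The quasi-inverse \<open>G\<close> is faithful too, by the isomorphism from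
      \<open>F \<circ>\<^sub>F G\<close> to the identity.\<close>
    then have "AMap F f = g"
      by (rule faithful_if_retract[OF G F FG F.AMap_in_Hom[OF f] g])
    with f show ?thesis by blast
  qed
  obtain \<sigma> where nat': "nat_trans D D (F \<circ>\<^sub>F G) id_funct \<sigma>" and inv': "\<And>d. d \<in> Obj D \<Longrightarrow> is_iso D (\<sigma> d)"
    using FG unfolding nat_isomorphic_def by blast
  have ess: "\<exists>c\<in>Obj C. \<exists>s\<in>Hom D (OMap F c) d. \<exists>t\<in>Hom D d (OMap F c).
      t \<cdot>\<^bsub>D\<^esub> s = Ident D (OMap F c) \<and> s \<cdot>\<^bsub>D\<^esub> t = Ident D d" if d: "d \<in> Obj D" for d
  proof -
    have s: "\<sigma> d \<in> Hom D (OMap F (OMap G d)) d" using nat' d by (simp add: nat_trans_def id_funct_def)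
    show ?thesis using isoE[OF inv'[OF d] s] s G.OMap_in_Obj[OF d] by metis
  qed
  show ?thesis
  proof (intro fully_faithful_ess_surj.intro fully_faithful_ess_surj_axioms.intro F ess)
    fix a b g assume *: "a \<in> Obj C" "b \<in> Obj C" "g \<in> Hom D (OMap F a) (OMap F b)"
    show "\<exists>!f. f \<in> Hom C a b \<and> AMap F f = g"
      using full[OF *] faithful_if_retract[OF F G GF] by blast
  qed
qed

section \<open>Cancelling equivalences from a composite\<close>

lemma is_functor_comp_funct:
  assumes "is_functor A B F" "is_functor B C G"
  shows "is_functor A C (G \<circ>\<^sub>F F)"
proof -
  interpret F: is_functor A B F by fact
  interpret G: is_functor B C G by fact
  show ?thesis
    by (intro is_functor.intro is_functor_axioms.intro F.source.category_axioms G.target.category_axioms)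
      (simp_all add: F.OMap_in_Obj G.OMap_in_Obj F.AMap_in_Hom G.AMap_in_Hom F.AMap_Ident G.AMap_Ident
        F.AMap_Comp G.AMap_Comp[OF F.AMap_in_Hom F.AMap_in_Hom])
qed

text \<open>A universal arrow from \<open>L x\<close> for the composite lifts along the full functor
  \<open>L\<close>, and faithfulness of \<open>L\<close> matches the two factorisation
  conditions.\<close>

lemma right_adjoint_functor_cancel_left:
  assumes K: "is_functor B C K" and L: "fully_faithful_ess_surj C D L"
    and LK: "right_adjoint_functor B D (L \<circ>\<^sub>F K)"
  shows "right_adjoint_functor B C K"
proof -
  interpret K: is_functor B C K by fact
  interpret L: fully_faithful_ess_surj C D L by fact
  interpret LK: right_adjoint_functor B D "L \<circ>\<^sub>F K" by fact
  show ?thesis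
  proof unfold_locales
    fix x assume x: "x \<in> Obj C"
    obtain b u where bu: "universal_arrow B D (L \<circ>\<^sub>F K) (OMap L x) b u"
      using LK.universal[OF L.OMap_in_Obj[OF x]] by blast
    then have b: "b \<in> Obj B" and u: "u \<in> Hom D (OMap L x) (OMap L (OMap K b))"
      by (auto simp: universal_arrow_def)
    obtain u' where u': "u' \<in> Hom C x (OMap K b)" "AMap L u' = u"
      using L.full[OF x K.OMap_in_Obj[OF b] u] .
    have "universal_arrow B C K x b u'"
      unfolding universal_arrow_def
    proof (intro conjI ballI)
      fix b' f assume b': "b' \<in> Obj B" and f: "f \<in> Hom C x (OMap K b')"
      have "AMap K g \<cdot>\<^bsub>C\<^esub> u' = f \<longleftrightarrow> AMap (L \<circ>\<^sub>F K) g \<cdot>\<^bsub>D\<^esub> u = AMap L f" if g: "g \<in> Hom B b b'" for g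
        using L.AMap_Comp[OF u'(1) K.AMap_in_Hom[OF g]] u'(2)
          L.faithful[OF K.target.Comp_in_Hom[OF u'(1) K.AMap_in_Hom[OF g]] f] by auto
      moreover have "\<exists>!g. g \<in> Hom B b b' \<and> AMap (L \<circ>\<^sub>F K) g \<cdot>\<^bsub>D\<^esub> u = AMap L f"
        using bu b' L.AMap_in_Hom[OF f] unfolding universal_arrow_def comp_funct_simps by blast
      ultimately show "\<exists>!g. g \<in> Hom B b b' \<and> AMap K g \<cdot>\<^bsub>C\<^esub> u' = f" by blast
    qed (use b u' in auto)
    then show "\<exists>b u. universal_arrow B C K x b u" by blast
  qed
qed

text \<open>A universal arrow \<open>d \<rightarrow> L (K b)\<close> for the composite is universal
  for \<open>L\<close> as well, since every object of \<open>C\<close> is isomorphic to some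
  \<open>K b'\<close>.\<close>

lemma right_adjoint_functor_cancel_right:
  assumes K: "fully_faithful_ess_surj B C K" and L: "is_functor C D L"
    and LK: "right_adjoint_functor B D (L \<circ>\<^sub>F K)"
  shows "right_adjoint_functor C D L"
proof -
  interpret K: fully_faithful_ess_surj B C K by fact
  interpret L: is_functor C D L by fact
  interpret LK: right_adjoint_functor B D "L \<circ>\<^sub>F K" by fact
  show ?thesis
  proof unfold_locales
    fix d assume d: "d \<in> Obj D"
    obtain b u where bu: "universal_arrow B D (L \<circ>\<^sub>F K) d b u"
      using LK.universal[OF d] by blast
    then have b: "b \<in> Obj B" and u: "u \<in> Hom D d (OMap L (OMap K b))"
      by (auto simp: universal_arrow_def)
    have "universal_arrow C D L d (OMap K b) u"
      unfolding universal_arrow_def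
    proof (intro conjI ballI)
      fix c f assume c: "c \<in> Obj C" and f: "f \<in> Hom D d (OMap L c)"
      obtain b' s t where b': "b' \<in> Obj B" and s: "s \<in> Hom C (OMap K b') c" and t: "t \<in> Hom C c (OMap K b')"
        and ts: "t \<cdot>\<^bsub>C\<^esub> s = Ident C (OMap K b')" and st: "s \<cdot>\<^bsub>C\<^esub> t = Ident C c"
        using K.ess_surj[OF c] by blast
      note Lt = L.AMap_in_Hom[OF t] and Ls = L.AMap_in_Hom[OF s]
      have Lst: "AMap L s \<cdot>\<^bsub>D\<^esub> (AMap L t \<cdot>\<^bsub>D\<^esub> h) = h" if h: "h \<in> Hom D d (OMap L c)" for h
        using L.comp_universal[OF h t s] by (simp add: st L.AMap_Ident[OF c] L.target.Ident_Comp[OF h])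
      \<comment> \<open>The test arrow is moved to the isomorphic object \<open>K b'\<close> and
        factored there; \<open>s\<close> brings the factor back to \<open>c\<close>.\<close>
      have "AMap L t \<cdot>\<^bsub>D\<^esub> f \<in> Hom D d (OMap (L \<circ>\<^sub>F K) b')"
        using L.target.Comp_in_Hom[OF f Lt] by simp
      from LK.transpose_exists[OF bu this b']
      obtain h where h: "h \<in> Hom B b b'" "AMap L (AMap K h) \<cdot>\<^bsub>D\<^esub> u = AMap L t \<cdot>\<^bsub>D\<^esub> f"
        by (metis comp_funct_simps(2))
      note Kh = K.AMap_in_Hom[OF h(1)]
      show "\<exists>!g. g \<in> Hom C (OMap K b) c \<and> AMap L g \<cdot>\<^bsub>D\<^esub> u = f"
      proof (rule ex1I[of _ "s \<cdot>\<^bsub>C\<^esub> AMap K h"], intro conjI)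
        show "s \<cdot>\<^bsub>C\<^esub> AMap K h \<in> Hom C (OMap K b) c" by (rule K.target.Comp_in_Hom[OF Kh s])
        show "AMap L (s \<cdot>\<^bsub>C\<^esub> AMap K h) \<cdot>\<^bsub>D\<^esub> u = f"
          using L.comp_universal[OF u Kh s] by (simp add: h(2) Lst[OF f])
        fix g assume "g \<in> Hom C (OMap K b) c \<and> AMap L g \<cdot>\<^bsub>D\<^esub> u = f"
        then have g: "g \<in> Hom C (OMap K b) c" and gf: "AMap L g \<cdot>\<^bsub>D\<^esub> u = f" by auto
        \<comment> \<open>Fullness of \<open>K\<close> puts \<open>t \<cdot> g\<close> in its range,
          where uniqueness for the composite applies.\<close>
        obtain h' where h': "h' \<in> Hom B b b'" "AMap K h' = t \<cdot>\<^bsub>C\<^esub> g"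
          using K.full[OF b b' K.target.Comp_in_Hom[OF g t]] .
        have "h' = h"
          using LK.transpose_unique[OF bu h'(1) h(1)] L.comp_universal[OF u g t]
          by (simp add: h'(2) h(2) gf)
        then show "g = s \<cdot>\<^bsub>C\<^esub> AMap K h"
          using K.target.Comp_assoc[OF g t s] by (simp add: h'(2)[symmetric] st K.target.Ident_Comp[OF g])
      qed
    qed (use b u K.OMap_in_Obj in auto)
    then show "\<exists>c u. universal_arrow C D L d c u" by blast
  qed
qed


section \<open>Injective and projective objects\<close>

text \<open>Extending \<open>f\<close> into \<open>G x\<close> along \<open>m\<close> transposes to
  extending \<open>\<epsilon> x \<cdot> F f\<close> along the monomorphism \<open>F m\<close>; a
  solution \<open>h\<close> there gives the extension
  \<open>G h \<cdot> \<eta> (Cod C m)\<close>.\<close>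

lemma adjoint_preserves_injectives:
  assumes adj: "adjoint C D F G" and mono: "\<And>m. is_mono C m \<Longrightarrow> is_mono D (AMap F m)"
  shows "preserves_injectives D C G"
  unfolding preserves_injectives_def
proof (intro allI impI)
  fix x assume inj: "is_injective D x"
  obtain \<eta> \<epsilon> where F: "is_functor C D F" and G: "is_functor D C G"
    and eta: "nat_trans C C id_funct (G \<circ>\<^sub>F F) \<eta>" and eps: "nat_trans D D (F \<circ>\<^sub>F G) id_funct \<epsilon>"
    and tri2: "\<And>d. d\<in>Obj D \<Longrightarrow> AMap G (\<epsilon> d) \<cdot>\<^bsub>C\<^esub> \<eta> (OMap G d) = Ident C (OMap G d)"
    using adj unfolding adjoint_def by blast
  interpret F: is_functor C D F by fact
  interpret G: is_functor D C G by fact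
  have etaH: "\<eta> c \<in> Hom C c (OMap G (OMap F c))" if "c \<in> Obj C" for c
    using eta that by (simp add: nat_trans_def id_funct_def)
  have eta_nat: "AMap G (AMap F f) \<cdot>\<^bsub>C\<^esub> \<eta> a = \<eta> b \<cdot>\<^bsub>C\<^esub> f" if "f \<in> Hom C a b" for f a b
    using eta that by (auto simp: nat_trans_def id_funct_def Hom_def)
  have x: "x \<in> Obj D" using inj by (simp add: is_injective_def)
  have ex: "\<epsilon> x \<in> Hom D (OMap F (OMap G x)) x"
    using eps x by (simp add: nat_trans_def id_funct_def)
  show "is_injective C (OMap G x)"
    unfolding is_injective_def
  proof (intro conjI allI impI ballI)
    show "OMap G x \<in> Obj C" by (rule G.OMap_in_Obj[OF x])
    fix m f assume m: "is_mono C m" and f: "f \<in> Hom C (Dom C m) (OMap G x)"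
    have mH: "m \<in> Hom C (Dom C m) (Cod C m)" using m by (simp add: is_mono_def Arr_Hom)
    note a = F.source.Hom_Obj(1)[OF mH] and b = F.source.Hom_Obj(2)[OF mH]
    note Fm = F.AMap_in_Hom[OF mH]
    have "\<epsilon> x \<cdot>\<^bsub>D\<^esub> AMap F f \<in> Hom D (Dom D (AMap F m)) x"
      using F.target.Comp_in_Hom[OF F.AMap_in_Hom[OF f] ex] by (simp add: Hom_Dom[OF Fm])
    then obtain h where "h \<in> Hom D (Cod D (AMap F m)) x" and hm: "h \<cdot>\<^bsub>D\<^esub> AMap F m = \<epsilon> x \<cdot>\<^bsub>D\<^esub> AMap F f"
      using inj mono[OF m] unfolding is_injective_def by blast
    then have h: "h \<in> Hom D (OMap F (Cod C m)) x" by (simp add: Hom_Cod[OF Fm])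
    note Gh = G.AMap_in_Hom[OF h]
    note eb = etaH[OF b] and ea = etaH[OF a]
    have "(AMap G h \<cdot>\<^bsub>C\<^esub> \<eta> (Cod C m)) \<cdot>\<^bsub>C\<^esub> m = AMap G h \<cdot>\<^bsub>C\<^esub> (AMap G (AMap F m) \<cdot>\<^bsub>C\<^esub> \<eta> (Dom C m))"
      using F.source.Comp_assoc[OF mH eb Gh] eta_nat[OF mH] by simp
    also have "\<dots> = AMap G (\<epsilon> x \<cdot>\<^bsub>D\<^esub> AMap F f) \<cdot>\<^bsub>C\<^esub> \<eta> (Dom C m)"
      using G.comp_universal[OF ea Fm h] by (simp add: hm)
    also have "\<dots> = AMap G (\<epsilon> x) \<cdot>\<^bsub>C\<^esub> (\<eta> (OMap G x) \<cdot>\<^bsub>C\<^esub> f)"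
      using G.comp_universal[OF ea F.AMap_in_Hom[OF f] ex] eta_nat[OF f] by simp
    also have "\<dots> = f"
      using F.source.Comp_assoc[OF f etaH[OF G.OMap_in_Obj[OF x]] G.AMap_in_Hom[OF ex]]
      by (simp add: tri2[OF x] F.source.Ident_Comp[OF f])
    finally show "\<exists>g\<in>Hom C (Cod C m) (OMap G x). g \<cdot>\<^bsub>C\<^esub> m = f"
      using F.source.Comp_in_Hom[OF eb Gh] by blast
  qed
qed

lemma adjoint_preserves_projectives:
  assumes "adjoint C D F G" and "\<And>e. is_epi D e \<Longrightarrow> is_epi C (AMap G e)"
  shows "preserves_projectives C D F"
  using adjoint_preserves_injectives[OF adjoint_op_cat[OF assms(1)]] assms(2)
  by (simp add: is_mono_op_cat preserves_injectives_op_cat)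

text \<open>Extend \<open>t \<cdot> f\<close> into \<open>x\<close> and return along
  \<open>s\<close>; applied below to isomorphic objects.\<close>

lemma (in category) injective_retract:
  assumes inj: "is_injective C x" and s: "s \<in> Hom C x y" and t: "t \<in> Hom C y x"
    and st: "s \<cdot> t = Ident C y"
  shows "is_injective C y"
  unfolding is_injective_def
proof (intro conjI allI impI ballI)
  show "y \<in> Obj C" using Hom_Obj(1)[OF t] .
  fix m f assume m: "is_mono C m" and f: "f \<in> Hom C (Dom C m) y"
  have mH: "m \<in> Hom C (Dom C m) (Cod C m)" using m by (simp add: is_mono_def Arr_Hom)
  obtain g where g: "g \<in> Hom C (Cod C m) x" "g \<cdot> m = t \<cdot> f"
    using inj m Comp_in_Hom[OF f t] unfolding is_injective_def by blast
  have "(s \<cdot> g) \<cdot> m = f"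
    using Comp_assoc[OF mH g(1) s] Comp_assoc[OF f t s] by (simp add: g(2) st Ident_Comp[OF f])
  then show "\<exists>g\<in>Hom C (Cod C m) y. g \<cdot> m = f" using Comp_in_Hom[OF g(1) s] by blast
qed

text \<open>As a right adjoint \<open>F\<close> preserves monomorphisms, so the extension exists in
  \<open>D\<close>; it lifts to \<open>C\<close> by fullness, and its equation by
  faithfulness.\<close>

lemma (in fully_faithful_ess_surj) reflects_injective:
  assumes inj: "is_injective D (OMap F x)" and x: "x \<in> Obj C"
  shows "is_injective C x"
  unfolding is_injective_def
proof (intro conjI allI impI ballI x)
  fix m f assume m: "is_mono C m" and f: "f \<in> Hom C (Dom C m) x"
  have mH: "m \<in> Hom C (Dom C m) (Cod C m)" using m by (simp add: is_mono_def Arr_Hom)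
  note Fm = AMap_in_Hom[OF mH]
  obtain h where "h \<in> Hom D (Cod D (AMap F m)) (OMap F x)" and hm: "h \<cdot>\<^bsub>D\<^esub> AMap F m = AMap F f"
    using inj right_adjoint_functor.preserves_mono[OF right_adjoint_functor m] AMap_in_Hom[OF f]
      Hom_Dom[OF Fm] unfolding is_injective_def by metis
  then obtain g where g: "g \<in> Hom C (Cod C m) x" "AMap F g = h"
    using full[OF source.Hom_Obj(2)[OF mH] x] Hom_Cod[OF Fm] by metis
  have "g \<cdot>\<^bsub>C\<^esub> m = f"
    using faithful[OF source.Comp_in_Hom[OF mH g(1)] f] AMap_Comp[OF mH g(1)] by (simp add: g(2) hm)
  then show "\<exists>g\<in>Hom C (Cod C m) x. g \<cdot>\<^bsub>C\<^esub> m = f" using g(1) by blast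
qed

text \<open>Essential surjectivity replaces \<open>x\<close> by an isomorphic \<open>K y\<close>.
  Injectivity passes to \<open>y\<close> as \<open>K\<close> reflects it, then through the
  composite, and back to \<open>F (K y)\<close> as \<open>L\<close> reflects it.\<close>

lemma preserves_injectives_cancel:
  assumes K: "fully_faithful_ess_surj A B K" and F: "is_functor B C F"
    and L: "fully_faithful_ess_surj C D L" and LFK: "preserves_injectives A D (L \<circ>\<^sub>F F \<circ>\<^sub>F K)"
  shows "preserves_injectives B C F"
  unfolding preserves_injectives_def
proof (intro allI impI)
  interpret K: fully_faithful_ess_surj A B K by fact
  interpret F: is_functor B C F by fact
  interpret L: fully_faithful_ess_surj C D L by fact
  fix x assume inj: "is_injective B x"
  then have "x \<in> Obj B" by (simp add: is_injective_def)
  then obtain y s t where y: "y \<in> Obj A" and s: "s \<in> Hom B (OMap K y) x" and t: "t \<in> Hom B x (OMap K y)"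
    and ts: "t \<cdot>\<^bsub>B\<^esub> s = Ident B (OMap K y)" and st: "s \<cdot>\<^bsub>B\<^esub> t = Ident B x"
    using K.ess_surj by blast
  have "is_injective A y"
    using K.reflects_injective[OF K.target.injective_retract[OF inj t s ts] y] .
  then have "is_injective D (OMap L (OMap F (OMap K y)))"
    using LFK unfolding preserves_injectives_def by simp
  then have "is_injective C (OMap F (OMap K y))"
    using L.reflects_injective F.OMap_in_Obj K.OMap_in_Obj y by blast
  then show "is_injective C (OMap F x)"
    using F.target.injective_retract[OF _ F.AMap_in_Hom[OF s] F.AMap_in_Hom[OF t]]
      F.AMap_Comp[OF t s] st F.AMap_Ident[OF \<open>x \<in> Obj B\<close>] by simp
qed


section \<open>Frobenius pairs\<close>

theorem proposition1p2:
  fixes C :: "('a, 'b) cat" and D :: "('c, 'd) cat"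
    and F :: "('a, 'b, 'c, 'd) funct" and G :: "('c, 'd, 'a, 'b) funct"
  assumes "category C" and "category D"
    and "is_functor C D F" and "is_functor D C G"
    and "frobenius_pair_second_kind C D F G"
  shows "(\<forall>J :: ('i, 'j) cat. category J \<longrightarrow>
             preserves_limits_of_shape J C D F \<and> preserves_colimits_of_shape J C D F \<and>
             preserves_limits_of_shape J D C G \<and> preserves_colimits_of_shape J D C G) \<and>
         (\<forall>I :: 'k set.
             preserves_products_over I C D F \<and> preserves_coproducts_over I C D F \<and>
             preserves_products_over I D C G \<and> preserves_coproducts_over I D C G) \<and>
         (preserves_kernels C D F \<and> preserves_cokernels C D F \<and>
          preserves_kernels D C G \<and> preserves_cokernels D C G) \<and>
         (preserves_initial C D F \<and> preserves_final C D F \<and>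
          preserves_initial D C G \<and> preserves_final D C G) \<and>
         (\<forall>addC addD. abelian C addC \<and> abelian D addD \<longrightarrow>
             exact_functor C addC D addD F \<and> exact_functor D addD C addC G \<and>
             preserves_injectives C D F \<and> preserves_projectives C D F \<and>
             preserves_injectives D C G \<and> preserves_projectives D C G)"
proof -
  obtain \<alpha> \<beta> where "equivalence C C \<alpha>" "equivalence D D \<beta>"
    and FG: "adjoint C D F G" and GF': "adjoint D C G (\<beta> \<circ>\<^sub>F F \<circ>\<^sub>F \<alpha>)"
    using assms(5) unfolding frobenius_pair_second_kind_def by blast
  then have \<alpha>: "fully_faithful_ess_surj C C \<alpha>" and \<beta>: "fully_faithful_ess_surj D D \<beta>"
    by (simp_all add: equivalence_fully_faithful_ess_surj)
  have \<beta>F: "is_functor C D (\<beta> \<circ>\<^sub>F F)"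
    by (rule is_functor_comp_funct[OF assms(3) fully_faithful_ess_surj.axioms(1)[OF \<beta>]])
  have LF: "left_adjoint_functor C D F" by (rule adjoint_left_adjoint_functor[OF FG])
  have RG: "right_adjoint_functor D C G" by (rule adjoint_right_adjoint_functor[OF FG])
  have LG: "left_adjoint_functor D C G" by (rule adjoint_left_adjoint_functor[OF GF'])
  \<comment> \<open>The composite \<open>\<beta> F \<alpha>\<close> is right adjoint to
    \<open>G\<close>; first \<open>\<alpha>\<close> is cancelled on the right, then
    \<open>\<beta>\<close> on the left.\<close>
  have RF: "right_adjoint_functor C D F"
    using right_adjoint_functor_cancel_left[OF assms(3) \<beta>]
      right_adjoint_functor_cancel_right[OF \<alpha> \<beta>F] adjoint_right_adjoint_functor[OF GF'] by blast
  \<comment> \<open>Each of the three factors is a left adjoint. With \<open>G\<close> left adjoint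
    to the composite, this makes \<open>G\<close> preserve projectives.\<close>
  have epi': "is_epi D (AMap (\<beta> \<circ>\<^sub>F F \<circ>\<^sub>F \<alpha>) e)" if "is_epi C e" for e
    using left_adjoint_functor_preserves_epi[OF fully_faithful_ess_surj.left_adjoint_functor[OF \<beta>]]
      left_adjoint_functor_preserves_epi[OF LF]
      left_adjoint_functor_preserves_epi[OF fully_faithful_ess_surj.left_adjoint_functor[OF \<alpha>]] that
    by simp
  \<comment> \<open>The left adjoint \<open>G\<close> of the composite preserves monomorphisms, so
    the composite preserves injectives; the equivalences are then cancelled.\<close>
  have "preserves_injectives C D F"
    by (rule preserves_injectives_cancel[OF \<alpha> assms(3) \<beta>
          adjoint_preserves_injectives[OF GF' right_adjoint_functor.preserves_mono[OF RG]]])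
  moreover have "preserves_projectives C D F"
    by (rule adjoint_preserves_projectives[OF FG left_adjoint_functor_preserves_epi[OF LG]])
  moreover have "preserves_injectives D C G"
    by (rule adjoint_preserves_injectives[OF FG right_adjoint_functor.preserves_mono[OF RF]])
  moreover have "preserves_projectives D C G"
    by (rule adjoint_preserves_projectives[OF GF' epi'])
  \<comment> \<open>Colimits of shape \<open>J\<close> are limits of shape \<open>op_cat J\<close>
    in the opposite categories, between which \<open>F\<close> and \<open>G\<close> are right
    adjoints.\<close>
  moreover have "preserves_colimits_of_shape J C D F" "preserves_colimits_of_shape J D C G"
    for J :: "('i, 'j) cat"
    using right_adjoint_functor.preserves_limits[OF LF, of "op_cat J"]
      right_adjoint_functor.preserves_limits[OF LG, of "op_cat J"]
    by (simp_all add: preserves_limits_of_shape_op_cat)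
  moreover have "preserves_coproducts_over I C D F" "preserves_coproducts_over I D C G"
    for I :: "'k set"
    using right_adjoint_functor.preserves_products[OF LF] right_adjoint_functor.preserves_products[OF LG]
    by (simp_all add: preserves_products_over_op_cat)
  moreover have "preserves_initial C D F" "preserves_initial D C G"
    using right_adjoint_functor.preserves_final[OF LF] right_adjoint_functor.preserves_final[OF LG]
    by (simp_all add: preserves_final_op_cat)
  ultimately show ?thesis
    using right_adjoint_functor.preserves_limits[OF RF] right_adjoint_functor.preserves_limits[OF RG]
      right_adjoint_functor.preserves_products[OF RF] right_adjoint_functor.preserves_products[OF RG]
      right_adjoint_functor.preserves_final[OF RF] right_adjoint_functor.preserves_final[OF RG]
      preserves_kernels_if_adjoint_both_sides[OF RF LF] preserves_kernels_if_adjoint_both_sides[OF RG LG]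
      preserves_cokernels_if_adjoint_both_sides[OF RF LF]
      preserves_cokernels_if_adjoint_both_sides[OF RG LG]
      exact_functor_if_adjoint_both_sides[OF RF LF] exact_functor_if_adjoint_both_sides[OF RG LG]
    by blast
qed

end
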